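(* Let $G$ be a 4-connected graph. Then $G$ contains a subdivision of $K_5^{-}$ as a subgraph.
   Context: $K_5^{-}$ denotes the graph obtained from the complete graph $K_5$ on five vertices by deleting a single edge. A subdivision of a graph $H$ is a graph obtained from $H$ by replacing each edge with a path between its endpoints, these paths being internally vertex-disjoint; $G$ contains an $H$-subdivision if some subgraph of $G$ is a subdivision of $H$. *)

theory Defs
  imports "Graph_Theory.Kuratowski"
begin

text \<open>
  As in the Graph\_Theory library, an undirected graph is a symmetric digraph, so that an edge
  \<open>uv\<close> is the pair of arcs \<open>(u, v)\<close>, \<open>(v, u)\<close>. The locale \<^locale>\<open>pair_graph\<close> then describes
  exactly the finite simple graphs.
\<close>

text \<open>
  The usual convention: more than \<open>k\<close> vertices, and no set of fewer than \<open>k\<close> vertices separates.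
  In particular the complete graph on \<open>k\<close> vertices is not \<open>k\<close>-connected.
\<close>

definition k_connected :: "nat \<Rightarrow> 'a pair_pre_digraph \<Rightarrow> bool" where
  "k_connected k G \<longleftrightarrow> card (pverts G) > k \<and>
    (\<forall>X \<subseteq> pverts G. card X < k \<longrightarrow> connected (with_proj G \<restriction> (pverts G - X)))"

definition delete_edge :: "'a pair_pre_digraph \<Rightarrow> 'a \<Rightarrow> 'a \<Rightarrow> 'a pair_pre_digraph" where
  "delete_edge G u v = G\<lparr>parcs := parcs G - {(u, v), (v, u)}\<rparr>"

definition complete_minus_edge :: "nat \<Rightarrow> 'a pair_pre_digraph \<Rightarrow> bool" where
  "complete_minus_edge n K \<longleftrightarrow>
    (\<exists>C u v. K\<^bsub>n\<^esub> (with_proj C) \<and> (u, v) \<in> parcs C \<and> K = delete_edge C u v)"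

text \<open>
  The first argument is a property of graphs, since a graph such as \<open>K\<^sub>5\<^sup>-\<close> is given only up to
  isomorphism. The library's \<^const>\<open>subdivision\<close> keeps the vertices of \<open>K\<close> as branch vertices of
  \<open>H\<close>, so \<open>K\<close> may be taken to live on vertices of \<open>G\<close>.
\<close>

definition contains_subdivision_of :: "('a pair_pre_digraph \<Rightarrow> bool) \<Rightarrow> 'a pair_pre_digraph \<Rightarrow> bool" where
  "contains_subdivision_of P G \<longleftrightarrow>
    (\<exists>H K. subgraph (with_proj H) (with_proj G) \<and> P K \<and> subdivision_pair K H)"

end

theory Submission
  imports Defs
begin

text \<open>
  A subdivision of \<open>K\<^sub>5\<^sup>-\<close> is essentially a cycle
  together with two disjoint connected sets \<open>U\<close>, \<open>V\<close> off the cycle that have three common neighbours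
  on it. Choose \<open>V\<close> connected and as large as possible such that the rest \<open>H\<close> still contains a
  subdivided \<open>K\<^sub>4\<close>; let \<open>N\<close> be the set of neighbours of \<open>V\<close> in \<open>H\<close>. Then deleting any vertex of
  \<open>N\<close> destroys all subdivided \<open>K\<^sub>4\<close> in \<open>H\<close>, and vertices of \<open>H\<close> outside \<open>N\<close> have degree at least 4
  in \<open>H\<close>. Suppress the vertices of degree 2 in \<open>H\<close>. A graph without subdivided \<open>K\<^sub>4\<close> has two
  vertices of degree at most 2, so every vertex of \<open>N\<close> has two neighbours of degree 3 in \<open>H\<close>, which
  lie in \<open>N\<close>. Hence there is a cycle in \<open>H\<close> consisting of vertices of degree 3 in \<open>N\<close>, chosen so that it
  does not cover \<open>H\<close>. A component \<open>U\<close> of the remainder has three neighbours on the cycle, since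
  otherwise at most two edges leave \<open>U\<close> and some subdivided \<open>K\<^sub>4\<close> would avoid a vertex of the cycle.
\<close>

section \<open>Linkage, cycles and wheels\<close>

text \<open>A graph is a bare relation \<open>E\<close> with a separate vertex set: vertices are
  deleted by shrinking the set, edges are added by enlarging the relation.\<close>

definition nbs :: "'a rel \<Rightarrow> 'a set \<Rightarrow> 'a \<Rightarrow> 'a set" where
  "nbs E W v = {u \<in> W. (v, u) \<in> E}"

text \<open>The closure is reflexive, so \<open>linked E X u u\<close> holds even for
  \<open>u\<close> outside \<open>X\<close>; a walk with distinct ends stays in
  \<open>X\<close>.\<close>

definition linked :: "'a rel \<Rightarrow> 'a set \<Rightarrow> 'a \<Rightarrow> 'a \<Rightarrow> bool" where
  "linked E X u v \<longleftrightarrow> (u, v) \<in> (Restr E X)\<^sup>*"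

definition conn :: "'a rel \<Rightarrow> 'a set \<Rightarrow> bool" where
  "conn E X \<longleftrightarrow> X \<noteq> {} \<and> (\<forall>u\<in>X. \<forall>v\<in>X. linked E X u v)"

text \<open>The first vertex is not repeated at the end; length at least 3 excludes an edge
  traversed back and forth.\<close>

definition cycle_list :: "'a rel \<Rightarrow> 'a list \<Rightarrow> bool" where
  "cycle_list E cs \<longleftrightarrow> distinct cs \<and> 3 \<le> length cs \<and>
     successively (\<lambda>u v. (u, v) \<in> E) cs \<and> (last cs, hd cs) \<in> E"

text \<open>
  The sets \<open>A\<close>, \<open>B\<close>, \<open>C\<close> contain the inner vertices of the three rim paths of a subdivided wheel
  whose hub has been blown up to the connected set \<open>U\<close>. Thus \<^term>\<open>wheel E W UNIV\<close> says that
  \<open>W\<close> contains a subdivision of \<open>K\<^sub>4\<close>.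
\<close>

definition wheel_at ::
  "'a rel \<Rightarrow> 'a set \<Rightarrow> 'a \<Rightarrow> 'a \<Rightarrow> 'a \<Rightarrow> 'a set \<Rightarrow> 'a set \<Rightarrow> 'a set \<Rightarrow> 'a set \<Rightarrow> bool" where
  "wheel_at E W a b c A B C U \<longleftrightarrow>
     a \<noteq> b \<and> b \<noteq> c \<and> a \<noteq> c \<and> {a, b, c} \<union> A \<union> B \<union> C \<union> U \<subseteq> W \<and>
     {a, b, c} \<inter> (A \<union> B \<union> C \<union> U) = {} \<and>
     A \<inter> B = {} \<and> A \<inter> C = {} \<and> B \<inter> C = {} \<and> U \<inter> (A \<union> B \<union> C) = {} \<and>
     linked E (A \<union> {b, c}) b c \<and> linked E (B \<union> {a, c}) a c \<and> linked E (C \<union> {a, b}) a b \<and>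
     conn E U \<and> nbs E U a \<noteq> {} \<and> nbs E U b \<noteq> {} \<and> nbs E U c \<noteq> {}"

definition wheel :: "'a rel \<Rightarrow> 'a set \<Rightarrow> 'a set \<Rightarrow> bool" where
  "wheel E W N \<longleftrightarrow> (\<exists>a\<in>N. \<exists>b\<in>N. \<exists>c\<in>N. \<exists>A B C U. wheel_at E W a b c A B C U)"

section \<open>Linkage and connected sets\<close>

lemma linked_refl [simp]: "linked E X u u"
  by (simp add: linked_def)

lemma linked_edge: "(u, v) \<in> E \<Longrightarrow> u \<in> X \<Longrightarrow> v \<in> X \<Longrightarrow> linked E X u v"
  by (auto simp: linked_def)

lemma linked_trans: "linked E X u v \<Longrightarrow> linked E X v w \<Longrightarrow> linked E X u w"
  by (auto simp: linked_def)

lemma linked_sym: "sym E \<Longrightarrow> linked E X u v \<Longrightarrow> linked E X v u"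
  unfolding linked_def by (rule symD[OF sym_rtrancl]) (auto simp: sym_def)

lemma linked_mono: "linked E X u v \<Longrightarrow> Restr E X \<subseteq> F \<Longrightarrow> X \<subseteq> Y \<Longrightarrow> linked F Y u v"
  unfolding linked_def by (erule rtrancl_mono[THEN subsetD, rotated]) auto

lemma linked_in: "linked E X u v \<Longrightarrow> u \<in> X \<Longrightarrow> v \<in> X"
  unfolding linked_def by (induction rule: rtrancl_induct) auto

lemma linked_start: "linked E X u v \<Longrightarrow> u \<noteq> v \<Longrightarrow> \<exists>w\<in>X. (u, w) \<in> E"
  unfolding linked_def by (auto elim: converse_rtranclE)

lemma conn_mono: "conn E X \<Longrightarrow> Restr E X \<subseteq> F \<Longrightarrow> conn F X"
  unfolding conn_def by (blast intro: linked_mono)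

lemma conn_singleton [simp]: "conn E {v}"
  by (auto simp: conn_def)

lemma connI:
  assumes "sym E" "r \<in> X" "\<And>v. v \<in> X \<Longrightarrow> linked E X r v"
  shows "conn E X"
  using assms unfolding conn_def by (metis empty_iff linked_sym linked_trans)

lemma conn_Un:
  assumes "sym E" "conn E X" "conn E Y" "x \<in> X" "y \<in> Y" "(x, y) \<in> E"
  shows "conn E (X \<union> Y)"
proof (rule connI[OF assms(1)])
  show "x \<in> X \<union> Y" using assms by auto
  fix v assume "v \<in> X \<union> Y"
  then show "linked E (X \<union> Y) x v"
  proof
    assume "v \<in> X"
    then have "linked E X x v" using assms by (auto simp: conn_def)
    then show ?thesis by (rule linked_mono) auto
  next
    assume "v \<in> Y"
    then have "linked E Y y v" using assms by (auto simp: conn_def)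
    then have "linked E (X \<union> Y) y v" by (rule linked_mono) auto
    moreover have "linked E (X \<union> Y) x y" using assms by (auto intro: linked_edge)
    ultimately show ?thesis by (rule linked_trans[rotated])
  qed
qed

lemma conn_insert:
  assumes "sym E" "conn E X" "x \<in> X" "(x, v) \<in> E"
  shows "conn E (insert v X)"
  using conn_Un[OF assms(1,2) conn_singleton[of E v] assms(3) _ assms(4)] by simp

section \<open>Paths and cycles as lists of vertices\<close>

lemma successively_linked:
  assumes "successively (\<lambda>u v. (u, v) \<in> E) cs" "cs \<noteq> []" "set cs \<subseteq> X" "v \<in> set cs"
  shows "linked E X (hd cs) v"
  using assms
proof (induction cs arbitrary: v)
  case (Cons x cs)
  show ?case
  proof (cases "cs = [] \<or> v = x")
    case False
    then have "linked E X (hd cs) v" "(x, hd cs) \<in> E"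
      using Cons by (auto simp: successively_Cons)
    moreover have "linked E X x (hd cs)"
      using False Cons by (intro linked_edge) (auto simp: successively_Cons)
    ultimately show ?thesis by (auto intro: linked_trans)
  qed (use Cons in auto)
qed simp

lemma conn_list:
  assumes "sym E" "successively (\<lambda>u v. (u, v) \<in> E) cs" "cs \<noteq> []"
  shows "conn E (set cs)"
  using assms by (intro connI[of E "hd cs"] successively_linked) auto

lemma cycle_list_rotate1: "cycle_list E cs \<Longrightarrow> cycle_list E (rotate1 cs)"
  by (cases cs) (auto simp: cycle_list_def successively_append_iff successively_Cons hd_append)

lemma cycle_list_rotate: "cycle_list E cs \<Longrightarrow> cycle_list E (rotate n cs)"
  by (induction n) (auto simp: cycle_list_rotate1)

lemma cycle_list_split:
  assumes "cycle_list E cs" "x \<in> set cs"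
  obtains ds where "cycle_list E (x # ds)" "set (x # ds) = set cs"
proof -
  obtain as bs where cs: "cs = as @ x # bs" using assms(2) by (meson split_list)
  have "cycle_list E (rotate (length as) cs)" using assms(1) by (rule cycle_list_rotate)
  moreover have "rotate (length as) cs = x # bs @ as"
    unfolding cs by (simp add: rotate_append)
  ultimately show ?thesis using that[of "bs @ as"] cs by auto
qed

text \<open>Rotating the cycle so that it starts at \<open>x\<close> turns the remaining vertices
  into a path.\<close>

lemma conn_cycle_minus:
  assumes "sym E" "cycle_list E cs" "x \<in> set cs"
  shows "conn E (set cs - {x})"
proof -
  obtain ds where ds: "cycle_list E (x # ds)" "set (x # ds) = set cs"
    using assms by (meson cycle_list_split)
  then have "set cs - {x} = set ds" "ds \<noteq> []" "successively (\<lambda>u v. (u, v) \<in> E) ds"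
    by (auto simp: cycle_list_def successively_Cons)
  then show ?thesis using conn_list assms(1) by metis
qed

text \<open>A wheel uses only edges with both ends in \<open>W\<close>, so the relations are
  compared on \<open>W\<close> alone. Auxiliary edges with an end outside \<open>W\<close> can thus
  be dropped again.\<close>

lemma wheel_mono:
  assumes "wheel E W N" "Restr E W \<subseteq> F" "W \<subseteq> W'" "W \<inter> N \<subseteq> N'"
  shows "wheel F W' N'"
proof -
  obtain a b c A B C U where *: "a \<in> N" "b \<in> N" "c \<in> N" "wheel_at E W a b c A B C U"
    using assms(1) by (auto simp: wheel_def)
  then have s: "{a,b,c} \<union> A \<union> B \<union> C \<union> U \<subseteq> W" by (auto simp: wheel_at_def)
  have l: "linked E X u v \<Longrightarrow> X \<subseteq> W \<Longrightarrow> linked F X u v" for X u v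
    using assms(2) by (erule_tac linked_mono) auto
  have n: "nbs E U v \<noteq> {} \<Longrightarrow> v \<in> W \<Longrightarrow> nbs F U v \<noteq> {}" for v
    using assms(2) s by (auto simp: nbs_def)
  have "conn E U \<Longrightarrow> conn F U"
    using assms(2) s by (erule_tac conn_mono) auto
  then have "wheel_at F W' a b c A B C U"
    using *(4) s assms(3) l[of "A \<union> {b,c}"] l[of "B \<union> {a,c}"] l[of "C \<union> {a,b}"] n
    unfolding wheel_at_def by simp blast
  moreover have "{a,b,c} \<subseteq> N'" using * s assms(4) by auto
  ultimately show ?thesis unfolding wheel_def by blast
qed

text \<open>Three vertices of \<open>N\<close> adjacent to \<open>U\<close> cut the cycle into the
  three rim paths of a wheel with hub \<open>U\<close>.\<close>

lemma wheel_cycle: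
  assumes "sym E" "cycle_list E cs" "set cs \<subseteq> W" "U \<subseteq> W - set cs" "conn E U"
    and three: "3 \<le> card {v \<in> set cs \<inter> N. nbs E U v \<noteq> {}}"
  shows "wheel E W N"
proof -
  let ?T = "{v \<in> set cs \<inter> N. nbs E U v \<noteq> {}}"
  obtain a b' c' where abc: "a \<noteq> b'" "a \<noteq> c'" "b' \<noteq> c'" "{a, b', c'} \<subseteq> ?T"
    using obtain_subset_with_card_n[OF three] by (metis card_3_iff)
  obtain ds where ds: "cycle_list E (a # ds)" "set (a # ds) = set cs"
    using abc assms by (metis (no_types, lifting) cycle_list_split insert_subset mem_Collect_eq IntD1)
  have "b' \<in> set ds" "c' \<in> set ds" using abc ds by auto
  \<comment> \<open>The names \<open>b\<close> and \<open>c\<close> follow the order of the two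
    vertices after \<open>a\<close>, so the cycle reads \<open>a\<close>, \<open>C\<close>,
    \<open>b\<close>, \<open>A\<close>, \<open>c\<close>, \<open>B\<close>.\<close>
  then obtain b c C A B where split: "ds = C @ b # A @ c # B" and bc: "{b, c} = {b', c'}"
  proof -
    obtain xs ys where xy: "ds = xs @ b' # ys" using \<open>b' \<in> set ds\<close> by (meson split_list)
    then have "c' \<in> set xs \<or> c' \<in> set ys" using \<open>c' \<in> set ds\<close> abc by auto
    then show thesis
    proof
      assume "c' \<in> set xs"
      then obtain us vs where "xs = us @ c' # vs" by (meson split_list)
      then show thesis using that[of us c' vs b' ys] xy by auto
    next
      assume "c' \<in> set ys"
      then obtain us vs where "ys = us @ c' # vs" by (meson split_list)
      then show thesis using that[of xs b' us c' vs] xy by auto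
    qed
  qed
  have "{a, b, c} \<subseteq> ?T" using abc bc by auto
  have d: "distinct (a # C @ b # A @ c # B)"
    and s: "successively (\<lambda>u v. (u, v) \<in> E) (a # C @ b # A @ c # B)"
    and l: "(last (c # B), a) \<in> E"
    using ds split by (auto simp: cycle_list_def)
  have "successively (\<lambda>u v. (u, v) \<in> E) (a # C @ [b])"
    "successively (\<lambda>u v. (u, v) \<in> E) (b # A @ [c])"
    "successively (\<lambda>u v. (u, v) \<in> E) (c # B @ [a])"
    using s l by (auto simp: successively_Cons successively_append_iff hd_append)
  note this[THEN successively_linked, OF _ subset_refl]
  from this(1)[of b] this(2)[of c] this(3)[of a]
  have "linked E (set C \<union> {a,b}) a b" "linked E (set A \<union> {b, c}) b c" "linked E (set B \<union> {a,c}) c a"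
    by (simp_all add: insert_commute)
  then have "wheel_at E W a b c (set A) (set B) (set C) U"
    unfolding wheel_at_def using d assms \<open>{a,b,c} \<subseteq> ?T\<close> ds(2)[symmetric] split
    by (auto dest: linked_sym)
  with \<open>{a,b,c} \<subseteq> ?T\<close> show ?thesis unfolding wheel_def by blast
qed

text \<open>A longest path has an end other than \<open>r\<close>, and all neighbours of that end
  lie on the path. Closing up at the nearest one beyond its successor gives a cycle without chords
  at its head; this later yields a vertex off the cycle.\<close>

lemma ex_cycle_list:
  assumes fin: "finite W" and E: "sym E" "irrefl E"
    and deg: "\<And>v. v \<in> W - {r} \<Longrightarrow> 2 \<le> card (nbs E W v)" and ne: "W - {r} \<noteq> {}"
  obtains cs where "cycle_list E cs" "set cs \<subseteq> W" "nbs E (set cs) (hd cs) \<subseteq> {cs ! 1, last cs}"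
proof -
  define P where "P = {xs. xs \<noteq> [] \<and> distinct xs \<and> set xs \<subseteq> W \<and> successively (\<lambda>u v. (u, v) \<in> E) xs}"
  have bound: "\<forall>xs. xs \<in> P \<longrightarrow> length xs < Suc (card W)"
    unfolding P_def using fin by (auto simp: less_Suc_eq_le card_mono simp flip: distinct_card)
  obtain v where v: "v \<in> W" "v \<noteq> r" using ne by auto
  then have "[v] \<in> P" by (simp add: P_def)
  from ex_has_greatest_nat[of "\<lambda>xs. xs \<in> P", OF this bound]
  obtain xs where xs: "xs \<in> P" and max: "\<And>ys. ys \<in> P \<Longrightarrow> length ys \<le> length xs" by blast
  have "2 \<le> card (nbs E W v)" using deg v by auto
  then obtain u where "u \<in> nbs E W v" by (metis all_not_in_conv card.empty not_numeral_le_zero)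
  then have "[v, u] \<in> P" using v E by (auto simp: P_def nbs_def irrefl_def)
  then have len: "2 \<le> length xs" using max by fastforce
  \<comment> \<open>The path is reversed if necessary, so that the degree bound applies at its
    head.\<close>
  define ys where "ys = (if hd xs = r then rev xs else xs)"
  have hd: "hd ys \<noteq> r"
  proof (cases "hd xs = r")
    case True
    have "distinct xs" using xs by (simp add: P_def)
    then have "last xs \<noteq> hd xs" using len
      by (cases xs) (auto simp: last_in_set split: if_splits)
    then show ?thesis using True len by (auto simp: ys_def hd_rev)
  qed (simp add: ys_def)
  have ys: "ys \<in> P" using xs E(1)
    by (auto simp: ys_def P_def successively_rev sym_def elim!: successively_mono)
  have maxy: "length zs \<le> length ys" if "zs \<in> P" for zs using max[OF that] by (auto simp: ys_def)
  obtain y zs where yz: "ys = y # zs" using ys by (cases ys) (auto simp: P_def)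
  have on: "nbs E W y \<subseteq> set zs"
  proof
    fix u assume u: "u \<in> nbs E W y"
    show "u \<in> set zs"
    proof (rule ccontr)
      assume "u \<notin> set zs"
      then have "u # ys \<in> P" using u ys yz E
        by (auto simp: P_def nbs_def irrefl_def sym_def successively_Cons)
      then show False using maxy by fastforce
    qed
  qed
  have "y \<in> W - {r}" using ys yz hd by (auto simp: P_def)
  then have "2 \<le> card (nbs E W y)" by (rule deg)
  then have "\<not> nbs E W y \<subseteq> {zs ! 0}"
    by (metis card.empty card_insert_disjoint card_mono empty_iff finite.emptyI finite.insertI not_less_eq_eq numeral_2_eq_2)
  then obtain w where w: "w \<in> nbs E W y" "w \<noteq> zs ! 0" by auto
  then obtain k where k: "k < length zs" "zs ! k = w" using on by (metis in_set_conv_nth subsetD)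
  then have "k \<ge> 1" using w by (cases k) auto
  \<comment> \<open>Index 0 is the successor of \<open>y\<close> on the path; excluding it makes the
    cycle have at least three vertices. The least index excludes chords at \<open>y\<close>.\<close>
  define Q where "Q j \<longleftrightarrow> 1 \<le> j \<and> j < length zs \<and> (y, zs ! j) \<in> E" for j
  define j where "j = (LEAST j. Q j)"
  have "Q k" using k w \<open>k \<ge> 1\<close> by (auto simp: Q_def nbs_def)
  then have j: "Q j" and least: "\<And>i. Q i \<Longrightarrow> j \<le> i" unfolding j_def by (auto intro: LeastI Least_le)
  define cs where "cs = y # take (Suc j) zs"
  have tk: "take (Suc j) zs \<noteq> []" "last (take (Suc j) zs) = zs ! j" "hd (take (Suc j) zs) = hd zs"
    using j by (auto simp: Q_def take_Suc_conv_app_nth hd_append hd_take)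
  have suc: "successively (\<lambda>u v. (u, v) \<in> E) (y # zs)" and dis: "distinct (y # zs)"
    using ys yz by (auto simp: P_def)
  have "successively (\<lambda>u v. (u, v) \<in> E) (take (Suc (Suc j)) (y # zs) @ drop (Suc (Suc j)) (y # zs))"
    using suc by simp
  then have "successively (\<lambda>u v. (u, v) \<in> E) cs"
    unfolding successively_append_iff by (simp add: cs_def)
  moreover have "distinct cs" using dis by (auto simp: cs_def dest: in_set_takeD)
  moreover have "length cs \<ge> 3" using j by (auto simp: cs_def Q_def)
  moreover have "(last cs, hd cs) \<in> E" using j tk E(1) by (auto simp: cs_def Q_def sym_def)
  ultimately have "cycle_list E cs" by (simp add: cycle_list_def)
  moreover have "set cs \<subseteq> W" using ys yz by (auto simp: cs_def P_def dest: in_set_takeD)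
  moreover have "nbs E (set cs) (hd cs) \<subseteq> {cs ! 1, last cs}"
  proof
    fix u assume u: "u \<in> nbs E (set cs) (hd cs)"
    then have "u \<in> set (take (Suc j) zs)" "(y, u) \<in> E" using E by (auto simp: cs_def nbs_def irrefl_def)
    then obtain i where i: "i \<le> j" "i < length zs" "u = zs ! i"
      by (auto simp: in_set_conv_nth less_Suc_eq_le)
    show "u \<in> {cs ! 1, last cs}"
    proof (cases "i = 0")
      case True
      then show ?thesis using i tk by (cases zs) (auto simp: cs_def)
    next
      case False
      then have "Q i" using i \<open>(y, u) \<in> E\<close> by (auto simp: Q_def)
      then have "i = j" using least[of i] i by auto
      then show ?thesis using i tk by (auto simp: cs_def)
    qed
  qed
  ultimately show thesis by (rule that)
qed

section \<open>Suppressing and subdividing\<close>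

lemma nbs_mono: "W \<subseteq> W' \<Longrightarrow> nbs E W v \<subseteq> nbs E W' v"
  by (auto simp: nbs_def)

lemma nbs_diff: "nbs E (W - X) v = nbs E W v - X"
  by (auto simp: nbs_def)

lemma finite_nbs [simp]: "finite W \<Longrightarrow> finite (nbs E W v)"
  by (simp add: nbs_def)

lemma card_nbs_remove:
  assumes "finite W"
  shows "card (nbs E W v) - 1 \<le> card (nbs E (W - {x}) v)"
  unfolding nbs_diff using assms by (simp add: card_Diff_singleton_if)

text \<open>Each passage of a walk through \<open>d\<close> is short-cut by an edge between the
  vertices before and after it.\<close>

lemma linked_bypass:
  assumes "linked E X u v" "u \<noteq> d" "v \<noteq> d" "Restr E X \<subseteq> F"
    and join: "\<And>y z. y \<in> X \<Longrightarrow> z \<in> X \<Longrightarrow> (y, d) \<in> E \<Longrightarrow> (d, z) \<in> E \<Longrightarrow> y \<noteq> d \<Longrightarrow> z \<noteq> d \<Longrightarrow> y \<noteq> z \<Longrightarrow> (y, z) \<in> F"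
  shows "linked F (X - {d}) u v"
proof -
  \<comment> \<open>While the walk stands at \<open>d\<close>, the invariant remembers the vertex
    \<open>p\<close> from which \<open>d\<close> was entered.\<close>
  have "if v = d then \<exists>p\<in>X - {d}. (p, d) \<in> E \<and> linked F (X - {d}) u p else linked F (X - {d}) u v"
    using assms(1)[unfolded linked_def]
  proof (induction rule: rtrancl_induct)
    case base
    then show ?case using assms(2) by simp
  next
    case (step v w)
    show ?case
    proof (cases "v = d")
      case True
      then obtain p where p: "p \<in> X - {d}" "(p, d) \<in> E" "linked F (X - {d}) u p" using step by auto
      show ?thesis
      proof (cases "w = d \<or> w = p")
        case False
        then have "(p, w) \<in> F" using join[of p w] p step True by auto
        then have "linked F (X - {d}) p w" using False p step by (intro linked_edge) auto
        then show ?thesis using False p linked_trans by metis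
      qed (use p in auto)
    next
      case False
      then have *: "linked F (X - {d}) u v" using step by simp
      show ?thesis
      proof (cases "w = d")
        case True
        then show ?thesis using * step False by auto
      next
        case w: False
        then have "linked F (X - {d}) v w" using step assms(4) False by (intro linked_edge) auto
        then show ?thesis using * w linked_trans by metis
      qed
    qed
  qed
  then show ?thesis using assms(3) by simp
qed

lemma three_nbs:
  assumes "finite W" "X \<union> Y \<union> Z \<subseteq> W" "X \<inter> Y = {}" "X \<inter> Z = {}" "Y \<inter> Z = {}"
    "nbs E X v \<noteq> {}" "nbs E Y v \<noteq> {}" "nbs E Z v \<noteq> {}"
  shows "3 \<le> card (nbs E W v)"
proof -
  obtain x y z where *: "x \<in> nbs E X v" "y \<in> nbs E Y v" "z \<in> nbs E Z v" using assms by blast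
  then have "x \<noteq> y" "x \<noteq> z" "y \<noteq> z" "{x, y, z} \<subseteq> nbs E W v"
    using assms by (auto simp: nbs_def)
  then have "card {x, y, z} \<le> card (nbs E W v)" using assms by (intro card_mono) auto
  with \<open>x \<noteq> y\<close> \<open>x \<noteq> z\<close> \<open>y \<noteq> z\<close> show ?thesis by simp
qed

text \<open>A vertex of degree at most 2 is none of \<open>a\<close>, \<open>b\<close>,
  \<open>c\<close>, so it can be bypassed in the rim path or hub that contains it. The case
  \<open>F = E\<close> says that a wheel can avoid \<open>d\<close> if distinct neighbours of
  \<open>d\<close> are already adjacent.\<close>

lemma wheel_suppress:
  assumes fin: "finite W" and E: "sym E" "irrefl E" and w: "wheel E W UNIV"
    and d: "card (nbs E W d) \<le> 2" and F: "Restr E W \<subseteq> F"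
    and join: "\<And>y z. y \<in> nbs E W d \<Longrightarrow> z \<in> nbs E W d \<Longrightarrow> y \<noteq> z \<Longrightarrow> (y, z) \<in> F"
  shows "wheel F (W - {d}) UNIV"
proof -
  obtain a b c A B C U where *: "wheel_at E W a b c A B C U"
    using w by (auto simp: wheel_def)
  note w = *[unfolded wheel_at_def]
  have nbs: "nbs E (X \<union> {v}) u \<noteq> {}" if "linked E (X \<union> {u, v}) u v" "u \<noteq> v" for X u v
    using linked_start[OF that] E(2) by (auto simp: nbs_def irrefl_def)
  have "linked E (A \<union> {c, b}) c b" "linked E (B \<union> {c, a}) c a" "linked E (C \<union> {b, a}) b a"
    using w E by (auto intro: linked_sym simp: insert_commute)
  note n = this[THEN nbs]
  \<comment> \<open>The two rim paths at \<open>a\<close> and the hub contribute one neighbour each,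
    in disjoint sets.\<close>
  have "3 \<le> card (nbs E W a)"
    by (rule three_nbs[OF fin, of "B \<union> {c}" "C \<union> {b}" U]) (use w nbs in auto)
  moreover have "3 \<le> card (nbs E W b)"
    by (rule three_nbs[OF fin, of "A \<union> {c}" "C \<union> {a}" U]) (use w nbs n in auto)
  moreover have "3 \<le> card (nbs E W c)"
    by (rule three_nbs[OF fin, of "A \<union> {b}" "B \<union> {a}" U]) (use w nbs n in auto)
  ultimately have dn: "d \<noteq> a" "d \<noteq> b" "d \<noteq> c" using d by auto
  have sym: "(u, v) \<in> E \<longleftrightarrow> (v, u) \<in> E" for u v using E(1) by (auto simp: sym_def)
  have irr: "(u, u) \<notin> E" for u using E(2) by (auto simp: irrefl_def)
  have join': "(y, z) \<in> F" if "y \<in> W" "z \<in> W" "(y, d) \<in> E" "(d, z) \<in> E" "y \<noteq> z" for y z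
    using join[of y z] that sym[of y d] by (simp add: nbs_def)
  have link: "linked F (X - {d} \<union> {u, v}) u v"
    if "linked E (X \<union> {u, v}) u v" "X \<union> {u, v} \<subseteq> W" "u \<noteq> d" "v \<noteq> d" for X u v
  proof -
    have "linked F (X \<union> {u, v} - {d}) u v"
      by (rule linked_bypass[OF that(1)]) (use that F join' in auto)
    moreover have "X \<union> {u, v} - {d} = X - {d} \<union> {u, v}" using that by auto
    ultimately show ?thesis by simp
  qed
  \<comment> \<open>Otherwise \<open>d\<close> would be the whole hub and have the three neighbours
    \<open>a\<close>, \<open>b\<close>, \<open>c\<close>.\<close>
  have "\<not> U \<subseteq> {d}"
  proof
    assume "U \<subseteq> {d}"
    then have "nbs E U v \<subseteq> nbs E {d} v" for v by (rule nbs_mono)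
    moreover have "nbs E U a \<noteq> {}" "nbs E U b \<noteq> {}" "nbs E U c \<noteq> {}" using w by simp_all
    ultimately have "nbs E {d} a \<noteq> {}" "nbs E {d} b \<noteq> {}" "nbs E {d} c \<noteq> {}" by blast+
    then have "(d, a) \<in> E" "(d, b) \<in> E" "(d, c) \<in> E" using sym by (auto simp: nbs_def)
    then have "{a, b, c} \<subseteq> nbs E W d" using w by (auto simp: nbs_def)
    then have "card {a, b, c} \<le> card (nbs E W d)" using fin by (intro card_mono) auto
    then show False using d w by simp
  qed
  then obtain u where u: "u \<in> U" "u \<noteq> d" by auto
  have "conn F (U - {d})"
    unfolding conn_def
  proof (intro conjI ballI)
    fix x y assume xy: "x \<in> U - {d}" "y \<in> U - {d}"
    show "linked F (U - {d}) x y"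
    proof (rule linked_bypass)
      have "conn E U" "U \<subseteq> W" using w by simp_all
      then show "linked E U x y" using xy by (simp add: conn_def)
      show "Restr E U \<subseteq> F" using F \<open>U \<subseteq> W\<close> by blast
      show "(p, q) \<in> F" if "p \<in> U" "q \<in> U" "(p, d) \<in> E" "(d, q) \<in> E" "p \<noteq> q" for p q
        using join' that \<open>U \<subseteq> W\<close> by blast
    qed (use xy in auto)
  qed (use u in auto)
  \<comment> \<open>If the neighbour of \<open>v\<close> in the hub is \<open>d\<close>, a neighbour
    \<open>y\<close> of \<open>d\<close> in the hub replaces it, by \<open>join'\<close>.\<close>
  moreover have nU: "nbs F (U - {d}) v \<noteq> {}" if "nbs E U v \<noteq> {}" "v \<in> W" "v \<notin> U" for v
  proof -
    obtain x where x: "x \<in> U" "(v, x) \<in> E" using \<open>nbs E U v \<noteq> {}\<close> by (auto simp: nbs_def)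
    show ?thesis
    proof (cases "x = d")
      case True
      have "linked E U d u" using w u True x by (auto simp: conn_def)
      then obtain y where y: "y \<in> U" "(d, y) \<in> E" using linked_start u by metis
      then have "(v, y) \<in> F" using join'[of v y] that x True w by auto
      then show ?thesis using y irr by (auto simp: nbs_def)
    next
      case False
      then show ?thesis using x F that w by (auto simp: nbs_def)
    qed
  qed
  moreover have "linked F (A - {d} \<union> {b, c}) b c" "linked F (B - {d} \<union> {a, c}) a c"
    "linked F (C - {d} \<union> {a, b}) a b"
    using w dn by (auto intro!: link[simplified])
  ultimately have "wheel_at F (W - {d}) a b c (A - {d}) (B - {d}) (C - {d}) (U - {d})"
    unfolding wheel_at_def using w dn nU[of a] nU[of b] nU[of c] by auto
  then show ?thesis unfolding wheel_def by blast
qed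

section \<open>Replacing an edge by a connected set\<close>

lemma linked_via:
  assumes "conn E Q" "p \<in> nbs E Q y" "(q, z) \<in> E" "q \<in> Q"
  shows "linked E (Q \<union> {y, z}) y z"
proof -
  have "linked E (Q \<union> {y, z}) y p" "linked E (Q \<union> {y, z}) q z"
    using assms by (auto intro!: linked_edge simp: nbs_def)
  moreover have "linked E Q p q" using assms by (auto simp: conn_def nbs_def)
  then have "linked E (Q \<union> {y, z}) p q" by (rule linked_mono) auto
  ultimately show ?thesis by (meson linked_trans)
qed

text \<open>The added edge is replaced by a detour through \<open>Q\<close>. Only a set
  \<open>X\<close> containing both ends can use that edge, so only such a set is enlarged; this
  keeps the pieces of a wheel disjoint.\<close>

lemma linked_subdivide:
  assumes "sym E" "conn E Q" "nbs E Q y \<noteq> {}" "nbs E Q z \<noteq> {}"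
    and "linked (insert (y, z) (insert (z, y) E)) X u v"
  shows "linked E (X \<union> (if y \<in> X \<and> z \<in> X then Q else {})) u v"
  using assms(5)[unfolded linked_def]
proof (induction rule: rtrancl_induct)
  case (step v w)
  let ?X = "X \<union> (if y \<in> X \<and> z \<in> X then Q else {})"
  obtain p q where pq: "p \<in> nbs E Q y" "q \<in> nbs E Q z" using assms by auto
  then have s: "(q, z) \<in> E" "q \<in> Q" "p \<in> Q" "(p, y) \<in> E"
    using assms(1) by (auto simp: nbs_def sym_def)
  have yz: "linked E ?X y z" if "y \<in> X" "z \<in> X"
    using linked_via[OF assms(2) pq(1) s(1,2)] by (rule linked_mono) (use that in auto)
  consider "(v, w) \<in> E" | "v = y" "w = z" | "v = z" "w = y" using step by auto
  then have "linked E ?X v w"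
    using yz linked_sym[OF assms(1)] step by cases (auto intro: linked_edge)
  with step show ?case by (meson linked_trans)
qed simp

text \<open>Here one end in \<open>U\<close> suffices for adding \<open>Q\<close>: a hub may be
  joined to a branch vertex by the added edge, and must then reach it through
  \<open>Q\<close>.\<close>

lemma conn_subdivide:
  assumes "sym E" "conn E Q" "nbs E Q y \<noteq> {}" "nbs E Q z \<noteq> {}"
    and "conn (insert (y, z) (insert (z, y) E)) U"
  shows "conn E (U \<union> (if y \<in> U \<or> z \<in> U then Q else {}))"
proof -
  have *: "conn E (U \<union> Q)" if "y \<in> U" and Q: "nbs E Q y \<noteq> {}" "nbs E Q z \<noteq> {}" and U: "conn (insert (y, z) (insert (z, y) E)) U" for y z
  proof (rule connI[OF assms(1)])
    show "y \<in> U \<union> Q" using that by simp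
    fix v assume "v \<in> U \<union> Q"
    then show "linked E (U \<union> Q) y v"
    proof
      assume "v \<in> U"
      then have "linked (insert (y, z) (insert (z, y) E)) U y v" using that by (auto simp: conn_def)
      from linked_subdivide[OF assms(1,2) Q this] show ?thesis by (rule linked_mono) (auto split: if_splits)
    next
      assume "v \<in> Q"
      moreover obtain p where "p \<in> Q" "(y, p) \<in> E" using Q by (auto simp: nbs_def)
      ultimately have "linked E (U \<union> Q) y p" "linked E Q p v"
        using that assms(2) by (auto simp: conn_def intro: linked_edge)
      moreover from this(2) have "linked E (U \<union> Q) p v" by (rule linked_mono) auto
      ultimately show ?thesis by (meson linked_trans)
    qed
  qed
  show ?thesis
  proof (cases "y \<in> U \<or> z \<in> U")
    case True
    then show ?thesis using *[of y z] *[of z y] assms by (auto simp: insert_commute)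
  next
    case False
    then show ?thesis using conn_mono[OF assms(5), of E] by auto
  qed
qed

text \<open>\<open>Q\<close> is added to whichever rim path or hub, if any, can use the added edge.
  The vertices \<open>a\<close>, \<open>b\<close>, \<open>c\<close> do not change, so
  \<open>N\<close> is kept.\<close>

lemma wheel_subdivide:
  assumes "sym E" "conn E Q" "nbs E Q y \<noteq> {}" "nbs E Q z \<noteq> {}" "y \<noteq> z" "W \<inter> Q = {}"
    and w: "wheel (insert (y, z) (insert (z, y) E)) W N"
  shows "wheel E (W \<union> Q) N"
proof -
  let ?E = "insert (y, z) (insert (z, y) E)"
  obtain a b c A B C U where abc: "a \<in> N" "b \<in> N" "c \<in> N" and *: "wheel_at ?E W a b c A B C U"
    using w by (auto simp: wheel_def)
  note w = *[unfolded wheel_at_def]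
  define p where "p X \<longleftrightarrow> y \<in> X \<and> z \<in> X" for X
  define A' where "A' = A \<union> (if p (A \<union> {b, c}) then Q else {})"
  define B' where "B' = B \<union> (if p (B \<union> {a, c}) then Q else {})"
  define C' where "C' = C \<union> (if p (C \<union> {a, b}) then Q else {})"
  define U' where "U' = U \<union> (if y \<in> U \<or> z \<in> U then Q else {})"
  \<comment> \<open>Two rim paths share at most one vertex and none meets the hub, so at most one of
    the four pieces receives \<open>Q\<close>.\<close>
  have excl: "\<not> (p (A \<union> {b, c}) \<and> p (B \<union> {a, c}))" "\<not> (p (A \<union> {b, c}) \<and> p (C \<union> {a, b}))"
    "\<not> (p (B \<union> {a, c}) \<and> p (C \<union> {a, b}))"
    "y \<in> U \<or> z \<in> U \<Longrightarrow> \<not> (p (A \<union> {b, c}) \<or> p (B \<union> {a, c}) \<or> p (C \<union> {a, b}))"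
  proof -
    have d: "(A \<union> {b, c}) \<inter> (B \<union> {a, c}) \<subseteq> {c}" "(A \<union> {b, c}) \<inter> (C \<union> {a, b}) \<subseteq> {b}"
      "(B \<union> {a, c}) \<inter> (C \<union> {a, b}) \<subseteq> {a}"
      "U \<inter> (A \<union> {b, c}) = {}" "U \<inter> (B \<union> {a, c}) = {}" "U \<inter> (C \<union> {a, b}) = {}"
      using w by auto
    show "\<not> (p (A \<union> {b, c}) \<and> p (B \<union> {a, c}))" using d(1) \<open>y \<noteq> z\<close> unfolding p_def by blast
    show "\<not> (p (A \<union> {b, c}) \<and> p (C \<union> {a, b}))" using d(2) \<open>y \<noteq> z\<close> unfolding p_def by blast
    show "\<not> (p (B \<union> {a, c}) \<and> p (C \<union> {a, b}))" using d(3) \<open>y \<noteq> z\<close> unfolding p_def by blast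
    show "\<not> (p (A \<union> {b, c}) \<or> p (B \<union> {a, c}) \<or> p (C \<union> {a, b}))" if "y \<in> U \<or> z \<in> U"
      using d(4-6) that unfolding p_def by blast
  qed
  define qA qB qC qU where q_def: "qA = (if p (A \<union> {b, c}) then Q else {})"
    "qB = (if p (B \<union> {a, c}) then Q else {})" "qC = (if p (C \<union> {a, b}) then Q else {})"
    "qU = (if y \<in> U \<or> z \<in> U then Q else {})"
  have q: "qA \<union> qB \<union> qC \<union> qU \<subseteq> Q" by (auto simp: q_def)
  have qdisj: "qA \<inter> qB = {}" "qA \<inter> qC = {}" "qB \<inter> qC = {}" "qU \<inter> (qA \<union> qB \<union> qC) = {}"
    using excl unfolding q_def by (simp_all split: if_splits)
  have sub: "{a, b, c} \<union> A \<union> B \<union> C \<union> U \<subseteq> W" "{a, b, c} \<inter> (A \<union> B \<union> C \<union> U) = {}"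
    "A \<inter> B = {}" "A \<inter> C = {}" "B \<inter> C = {}" "U \<inter> (A \<union> B \<union> C) = {}"
    using w by simp_all
  have disj: "A' \<inter> B' = {}" "A' \<inter> C' = {}" "B' \<inter> C' = {}" "U' \<inter> (A' \<union> B' \<union> C') = {}"
    "{a, b, c} \<inter> (A' \<union> B' \<union> C' \<union> U') = {}" "{a, b, c} \<union> A' \<union> B' \<union> C' \<union> U' \<subseteq> W \<union> Q"
  proof -
    note eqs = A'_def[folded q_def] B'_def[folded q_def] C'_def[folded q_def] U'_def[folded q_def]
    have W: "X \<inter> qA = {} \<and> X \<inter> qB = {} \<and> X \<inter> qC = {} \<and> X \<inter> qU = {} \<and>
      qA \<inter> X = {} \<and> qB \<inter> X = {} \<and> qC \<inter> X = {} \<and> qU \<inter> X = {}" if "X \<subseteq> W" for X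
      using that q \<open>W \<inter> Q = {}\<close> by blast
    have "A \<subseteq> W" "B \<subseteq> W" "C \<subseteq> W" "U \<subseteq> W" "{a, b, c} \<subseteq> W" using sub(1) by blast+
    note this[THEN W]
    note * = this sub(2-6) qdisj
    show "A' \<inter> B' = {}" "A' \<inter> C' = {}" "B' \<inter> C' = {}" "U' \<inter> (A' \<union> B' \<union> C') = {}"
      "{a, b, c} \<inter> (A' \<union> B' \<union> C' \<union> U') = {}"
      using * by (simp_all only: eqs Int_Un_distrib Int_Un_distrib2 Un_empty simp_thms)
    show "{a, b, c} \<union> A' \<union> B' \<union> C' \<union> U' \<subseteq> W \<union> Q" using sub(1) q unfolding eqs by blast
  qed
  note ls = linked_subdivide[OF assms(1-4)]
  have assoc: "X \<union> Z \<union> Y = (X \<union> Y) \<union> Z" for X Y Z :: "'a set" by blast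
  have "linked ?E (A \<union> {b, c}) b c" using w by (elim conjE)
  from ls[OF this] have "linked E (A' \<union> {b, c}) b c" unfolding A'_def p_def by (subst assoc)
  moreover have "linked ?E (B \<union> {a, c}) a c" using w by (elim conjE)
  from ls[OF this] have "linked E (B' \<union> {a, c}) a c" unfolding B'_def p_def by (subst assoc)
  moreover have "linked ?E (C \<union> {a, b}) a b" using w by (elim conjE)
  from ls[OF this] have "linked E (C' \<union> {a, b}) a b" unfolding C'_def p_def by (subst assoc)
  moreover have "conn E U'" unfolding U'_def using w by (intro conn_subdivide[OF assms(1-4)]) simp
  \<comment> \<open>If \<open>v\<close> sees the hub along the added edge, the other end lies in
    \<open>U\<close>; then \<open>Q\<close> is part of \<open>U'\<close> and contains a neighbour of
    \<open>v\<close>.\<close>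
  moreover have "nbs E U' v \<noteq> {}" if "nbs ?E U v \<noteq> {}" for v
    using that assms(3,4) unfolding U'_def by (auto simp: nbs_def)
  ultimately have "wheel_at E (W \<union> Q) a b c A' B' C' U'"
    using w disj unfolding wheel_at_def by simp
  with abc show ?thesis unfolding wheel_def by blast
qed

section \<open>Subdivided K4 from minimum degree 3\<close>

text \<open>Dirac's theorem, with one exceptional vertex allowed. Choose a connected
  \<open>V\<close> containing it, as large as possible such that a cycle remains in the rest
  \<open>H\<close>. Deleting a neighbour of \<open>V\<close> from \<open>H\<close> destroys all
  cycles, so these neighbours lie on one cycle. If there are any, there are three; if there are
  none, induction applies to \<open>H\<close>.\<close>

lemma wheel_if_degree_ge_3:
  assumes "finite W" and E: "sym E" "irrefl E"
    and "\<And>v. v \<in> W - {r} \<Longrightarrow> 3 \<le> card (nbs E W v)" "W - {r} \<noteq> {}"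
  shows "wheel E W UNIV"
  using assms(1,4,5)
proof (induction "card W" arbitrary: W r rule: less_induct)
  case (less W r)
  have irr: "(u, u) \<notin> E" for u using E(2) by (auto simp: irrefl_def)
  \<comment> \<open>The exceptional vertex may be taken in \<open>W\<close>: if \<open>r\<close> is
    outside, any vertex of \<open>W\<close> can play its role.\<close>
  have "\<exists>s\<in>W. (\<forall>v\<in>W - {s}. 3 \<le> card (nbs E W v)) \<and> W - {s} \<noteq> {}"
  proof (cases "r \<in> W")
    case False
    then obtain v where v: "v \<in> W" "3 \<le> card (nbs E W v)" using less.prems by fastforce
    then have "nbs E W v \<noteq> {}" by auto
    then obtain u where "u \<in> W" "u \<noteq> v" using irr by (auto simp: nbs_def)
    then show ?thesis using v less.prems False by (intro bexI[of _ v]) auto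
  qed (use less.prems in auto)
  then obtain s where s: "s \<in> W" and deg: "\<And>v. v \<in> W - {s} \<Longrightarrow> 3 \<le> card (nbs E W v)" "W - {s} \<noteq> {}"
    by blast
  define P where "P V \<longleftrightarrow> s \<in> V \<and> V \<subseteq> W \<and> conn E V \<and> (\<exists>cs. cycle_list E cs \<and> set cs \<subseteq> W - V)" for V
  have dropdeg: "2 \<le> card (nbs E (X - {x}) v)" if "3 \<le> card (nbs E X v)" "X \<subseteq> W" for X x v
    using card_nbs_remove[of X E v x] that less.prems(1) finite_subset[of X W] by fastforce
  have "\<exists>cs. cycle_list E cs \<and> set cs \<subseteq> W - {s}"
    by (rule ex_cycle_list[OF _ E, of "W - {s}" s]) (use less.prems deg dropdeg in auto)
  then have "P {s}" using s by (auto simp: P_def)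
  moreover have "\<forall>V. P V \<longrightarrow> card V < Suc (card W)"
    using less.prems by (auto simp: P_def less_Suc_eq_le intro: card_mono)
  ultimately obtain V where V: "P V" and max: "\<And>X. P X \<Longrightarrow> card X \<le> card V"
    using ex_has_greatest_nat[of P "{s}" card "Suc (card W)"] by blast
  define H where "H = W - V"
  define N where "N = {v \<in> H. nbs E V v \<noteq> {}}"
  obtain cs where cs: "cycle_list E cs" "set cs \<subseteq> H" using V by (auto simp: P_def H_def)
  have Vs: "s \<in> V" "V \<subseteq> W" "conn E V" using V by (auto simp: P_def)
  have finH: "finite H" "finite V" using less.prems Vs by (auto simp: H_def intro: finite_subset)
  \<comment> \<open>Otherwise \<open>V\<close> could absorb \<open>x\<close>, against its
    maximality.\<close>
  have acyc: "\<not> (cycle_list E ds \<and> set ds \<subseteq> H - {x})" if "x \<in> N" for x ds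
  proof
    assume *: "cycle_list E ds \<and> set ds \<subseteq> H - {x}"
    obtain u where "u \<in> V" "(u, x) \<in> E"
      using \<open>x \<in> N\<close> E(1) by (auto simp: N_def nbs_def dest: symD)
    then have "conn E (insert x V)" using conn_insert E Vs by metis
    then have "P (insert x V)" using * Vs \<open>x \<in> N\<close> by (auto simp: P_def H_def N_def)
    then show False using max[of "insert x V"] \<open>x \<in> N\<close> finH by (auto simp: N_def H_def)
  qed
  have nbsH: "nbs E H v = nbs E W v" if "v \<in> H" "v \<notin> N" for v
    using that Vs by (auto simp: N_def H_def nbs_def)
  have degH: "3 \<le> card (nbs E H v)" if "v \<in> H" "v \<notin> N" for v
    using that deg(1)[of v] Vs nbsH[OF that] by (auto simp: H_def)
  have c3: "3 \<le> card (set cs)" using cs by (auto simp: cycle_list_def distinct_card)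
  show ?case
  proof (cases "N = {}")
    case True
    have "card H < card W" unfolding H_def using Vs less.prems by (intro psubset_card_mono) auto
    \<comment> \<open>No edge joins \<open>H\<close> to \<open>V\<close>, so all degrees survive. As
      \<open>s\<close> lies outside \<open>H\<close>, no vertex of \<open>H\<close> is
      exceptional.\<close>
    then have "wheel E H UNIV"
      by (rule less.hyps[where r = s]) (use finH degH True cs Vs c3 in \<open>auto simp: H_def\<close>)
    then show ?thesis by (rule wheel_mono) (auto simp: H_def)
  next
    case False
    then obtain x where x: "x \<in> N" by auto
    \<comment> \<open>With at most two vertices in \<open>N\<close>, deleting \<open>x\<close>
      leaves degree at least 2 except possibly at the other one, hence a cycle.\<close>
    have "3 \<le> card N"
    proof (rule ccontr)
      assume "\<not> 3 \<le> card N"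
      then have "card (N - {x}) \<le> 1"
        using x finH by (simp add: N_def card_Diff_singleton)
      have "finite (N - {x})" using finH by (simp add: N_def)
      obtain y where y: "N - {x} \<subseteq> {y}"
      proof (cases "N - {x} = {}")
        case False
        then have "card (N - {x}) = 1"
          using \<open>card (N - {x}) \<le> 1\<close> \<open>finite (N - {x})\<close> by (simp add: le_Suc_eq)
        then show ?thesis using that by (metis card_1_singletonE order_refl)
      qed (use that in blast)
      have "\<not> set cs \<subseteq> {x, y}"
        using c3 card_mono[of "{x, y}" "set cs"] card_insert_le_m1[of 2 "{y}" x] by auto
      then have "H - {x} - {y} \<noteq> {}" using cs by auto
      moreover have "2 \<le> card (nbs E (H - {x}) v)" if "v \<in> H - {x} - {y}" for v
        using that y degH by (intro dropdeg) (auto simp: H_def)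
      ultimately obtain ds where "cycle_list E ds" "set ds \<subseteq> H - {x}"
        using finH(1) by (rule_tac ex_cycle_list[OF _ E, of "H - {x}" y]) blast+
      then show False using acyc x by blast
    qed
    have "N \<subseteq> {v \<in> set cs \<inter> UNIV. nbs E V v \<noteq> {}}"
      using acyc cs by (auto simp: N_def)
    then have "card N \<le> card {v \<in> set cs \<inter> UNIV. nbs E V v \<noteq> {}}" by (intro card_mono) auto
    with \<open>3 \<le> card N\<close> show ?thesis
      using cs Vs by (intro wheel_cycle[OF E(1) cs(1), of W V]) (auto simp: H_def)
  qed
qed

section \<open>Graphs in which every wheel meets a given set\<close>

text \<open>Every vertex on a walk from \<open>w\<close> is itself linked to \<open>w\<close>, so
  the walk never leaves the component.\<close>

lemma linked_component:
  "linked E X w v \<Longrightarrow> linked E {u. linked E X w u} w v"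
  unfolding linked_def[of E X w v]
proof (induction rule: rtrancl_induct)
  case (step u v)
  then have "linked E X w u" by (simp add: linked_def)
  moreover from this have "linked E X w v" using step by (auto intro: linked_trans linked_edge)
  ultimately have "linked E {u. linked E X w u} u v" using step by (intro linked_edge) auto
  with step show ?case by (meson linked_trans)
qed simp

lemma cycle_list_nbs:
  assumes "sym E" "cycle_list E cs" "x \<in> set cs"
  shows "2 \<le> card (nbs E (set cs) x)"
proof -
  obtain ds where ds: "cycle_list E (x # ds)" "set (x # ds) = set cs"
    using assms by (meson cycle_list_split)
  obtain y z es where yz: "ds = y # z # es"
    using ds(1) by (cases ds; cases "tl ds") (auto simp: cycle_list_def)
  have "y \<noteq> last (z # es)"
    using ds(1) yz last_in_set[of "z # es"] by (auto simp: cycle_list_def simp del: last.simps)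
  moreover have "{y, last (z # es)} \<subseteq> nbs E (set cs) x"
    using ds yz assms(1) last_in_set[of "z # es"]
    by (auto simp: cycle_list_def nbs_def dest: symD simp flip: ds(2))
  then have "card {y, last (z # es)} \<le> card (nbs E (set cs) x)" by (intro card_mono) auto
  ultimately show ?thesis by simp
qed

text \<open>The vertices of degree 3 contain a cycle, and a component of the rest serves as hub. If
  it had fewer than three neighbours on the cycle, a wheel would survive the deletion of some vertex
  of the cycle. The vertex \<open>x\<close> ensures that \<open>N\<close> is nonempty.\<close>

lemma wheel_degree_3:
  assumes fin: "finite H" and E: "sym E" "irrefl E"
    and deg: "\<And>v. v \<in> H \<Longrightarrow> 3 \<le> card (nbs E H v)"
    and N: "N = {v \<in> H. card (nbs E H v) = 3}"
    and crit: "\<And>x. x \<in> N \<Longrightarrow> \<not> wheel E (H - {x}) UNIV"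
    and x: "x \<in> H" "\<not> wheel E (H - {x}) UNIV"
  shows "wheel E H N"
proof -
  have irr: "(u, u) \<notin> E" for u using E(2) by (auto simp: irrefl_def)
  have sym: "(v, u) \<in> E" if "(u, v) \<in> E" for u v using E(1) that by (auto dest: symD)
  \<comment> \<open>Since \<open>H - {x}\<close> has no wheel, two of its vertices have degree at
    most 2 there. Each lost \<open>x\<close> as a neighbour, so it had degree exactly 3.\<close>
  have N2: "2 \<le> card (nbs E N x)" if x: "x \<in> H" "\<not> wheel E (H - {x}) UNIV" for x
  proof -
    have "\<exists>v\<in>nbs E N x. v \<noteq> r" for r
    proof -
      have "nbs E H x \<subseteq> H - {x}" using irr by (auto simp: nbs_def)
      then have "card (nbs E H x) \<le> card (H - {x})" using fin by (intro card_mono) auto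
      then have "3 \<le> card (H - {x})" using deg[OF x(1)] by simp
      then have "\<not> H - {x} \<subseteq> {r}" using card_mono[of "{r}" "H - {x}"] by auto
      then have "H - {x} - {r} \<noteq> {}" by blast
      then obtain v where v: "v \<in> H - {x} - {r}" "\<not> 3 \<le> card (nbs E (H - {x}) v)"
        using wheel_if_degree_ge_3[of "H - {x}" E r] fin E x(2) by blast
      have "3 \<le> card (nbs E H v)" using v deg by auto
      then have "x \<in> nbs E H v" "card (nbs E H v) = 3"
        using v(2) fin unfolding nbs_diff by (auto simp: card_Diff_singleton_if split: if_splits)
      then show ?thesis using v sym by (auto simp: N nbs_def)
    qed
    then obtain v w where "{v, w} \<subseteq> nbs E N x" "v \<noteq> w" by blast
    moreover have "card {v, w} \<le> card (nbs E N x)"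
      using calculation fin by (intro card_mono) (auto simp: N)
    ultimately show ?thesis by simp
  qed
  have "nbs E N x \<noteq> {}" using N2[OF x] by auto
  then have "N - {x} \<noteq> {}" using irr by (auto simp: nbs_def)
  moreover have "2 \<le> card (nbs E N v)" if "v \<in> N - {x}" for v
    using N2[of v] crit that by (auto simp: N)
  moreover have "finite N" using fin by (simp add: N)
  ultimately obtain cs where cs: "cycle_list E cs" "set cs \<subseteq> N" "nbs E (set cs) (hd cs) \<subseteq> {cs ! 1, last cs}"
    by (rule_tac ex_cycle_list[OF _ E, of N x])
  define C where "C = set cs"
  have C: "C \<subseteq> N" "C \<subseteq> H" "finite C" and c3: "3 \<le> card C"
    using cs by (auto simp: C_def N cycle_list_def distinct_card)
  have hd: "hd cs \<in> C" using cs by (cases cs) (auto simp: C_def cycle_list_def)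
  have "card (nbs E C (hd cs)) \<le> card {cs ! 1, last cs}"
    unfolding C_def using cs(3) by (intro card_mono) auto
  also have "\<dots> \<le> 2" by (simp add: card_insert_if)
  \<comment> \<open>The head of the cycle has no chord, so its third neighbour lies off the
    cycle.\<close>
  finally have "\<not> nbs E H (hd cs) \<subseteq> nbs E C (hd cs)"
    using deg[of "hd cs"] hd C card_mono[of "nbs E C (hd cs)" "nbs E H (hd cs)"] by auto
  then obtain w where w: "w \<in> H - C" by (auto simp: nbs_def)
  define U where "U = {u. linked E (H - C) w u}"
  define T where "T = {v \<in> C \<inter> N. nbs E U v \<noteq> {}}"
  have U: "U \<subseteq> H - C" using linked_in[OF _ w] by (auto simp: U_def)
  have "w \<in> U" by (simp add: U_def)
  have connU: "conn E U"
    using linked_component by (intro connI[OF E(1) \<open>w \<in> U\<close>]) (auto simp: U_def)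
  have closed: "u \<in> U" if "v \<in> U" "(v, u) \<in> E" "u \<in> H - C" for u v
    using that U linked_trans[of E "H - C" w v u] linked_edge[of v u E "H - C"] by (auto simp: U_def)
  have nbsU: "nbs E H v \<subseteq> nbs E U v \<union> nbs E T v" if "v \<in> U" for v
    using closed[OF that] that C sym by (auto simp: nbs_def T_def)
  \<comment> \<open>A vertex of the cycle has degree 3 and two of its neighbours are on the
    cycle.\<close>
  have one: "u = v" if "c \<in> C" "u \<in> nbs E U c" "v \<in> nbs E U c" for c u v
  proof (rule ccontr)
    assume "u \<noteq> v"
    have "nbs E C c \<inter> {u, v} = {}" using that U by (auto simp: nbs_def)
    then have "card (nbs E C c \<union> {u, v}) = card (nbs E C c) + 2"
      using \<open>u \<noteq> v\<close> C by (subst card_Un_disjoint) auto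
    moreover have "2 \<le> card (nbs E C c)"
      using cycle_list_nbs[OF E(1) cs(1)] that by (simp add: C_def)
    moreover have "nbs E C c \<union> {u, v} \<subseteq> nbs E H c" using that U C by (auto simp: nbs_def)
    then have "card (nbs E C c \<union> {u, v}) \<le> card (nbs E H c)" using fin by (intro card_mono) auto
    moreover have "card (nbs E H c) = 3" using that C by (auto simp: N)
    ultimately show False by simp
  qed
  have finU: "finite U" "finite T" using U fin C by (auto intro: finite_subset simp: T_def)
  have "3 \<le> card T"
  proof (rule ccontr)
    assume T: "\<not> 3 \<le> card T"
    define K where "K = {v \<in> U. nbs E T v \<noteq> {}}"
    show False
    proof (cases "\<exists>r. K \<subseteq> {r}")
      \<comment> \<open>All edges from \<open>U\<close> to the cycle start at \<open>r\<close>, so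
        the other vertices of \<open>U\<close> keep degree at least 3 within
        \<open>U\<close>.\<close>
      case True
      then obtain r where r: "K \<subseteq> {r}" by auto
      have "U - {r} \<noteq> {}"
      proof
        assume "U - {r} = {}"
        then have "U = {w}" using \<open>w \<in> U\<close> by auto
        then have "nbs E U w = {}" using irr by (auto simp: nbs_def)
        then have "nbs E H w \<subseteq> T" using nbsU[OF \<open>w \<in> U\<close>] by (auto simp: nbs_def)
        then have "card (nbs E H w) \<le> card T" using finU by (intro card_mono)
        then show False using deg[of w] w T by auto
      qed
      moreover have "3 \<le> card (nbs E U v)" if "v \<in> U - {r}" for v
      proof -
        have "nbs E H v \<subseteq> nbs E U v" using nbsU[of v] that r by (auto simp: K_def)
        then have "card (nbs E H v) \<le> card (nbs E U v)" using finU by (intro card_mono) auto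
        then show ?thesis using deg[of v] that U by auto
      qed
      ultimately have "wheel E U UNIV" using wheel_if_degree_ge_3[OF finU(1) E] by blast
      then have "wheel E (H - {hd cs}) UNIV" by (rule wheel_mono) (use U hd in auto)
      then show False using crit hd C by blast
    next
      case False
      then have "K \<noteq> {}" by blast
      then obtain u where "u \<in> K" by blast
      moreover obtain u' where "u' \<in> K" "u' \<noteq> u" using False by blast
      ultimately obtain p q where pq: "p \<in> T" "q \<in> T" "(u, p) \<in> E" "(u', q) \<in> E" "u \<in> U" "u' \<in> U"
        by (auto simp: K_def nbs_def)
      have "p \<in> C" "q \<in> C" using pq by (auto simp: T_def)
      have only_u: "v = u" if "v \<in> U" "(v, p) \<in> E" for v
        using one[OF \<open>p \<in> C\<close>, of v u] that pq sym by (auto simp: nbs_def)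
      have only_u': "v = u'" if "v \<in> U" "(v, q) \<in> E" for v
        using one[OF \<open>q \<in> C\<close>, of v u'] that pq sym by (auto simp: nbs_def)
      have "p \<noteq> q" using only_u[OF pq(6)] pq \<open>u' \<noteq> u\<close> by blast
      then have "card T \<le> card {p, q}" using T by simp
      then have Tpq: "T = {p, q}" using card_seteq[OF finU(2), of "{p, q}"] pq by simp
      have "p \<notin> U" "q \<notin> U" "p \<noteq> u'" using pq U \<open>p \<in> C\<close> \<open>q \<in> C\<close> by auto
      \<comment> \<open>\<open>p\<close> stands for the whole cycle, through which \<open>u\<close> and \<open>u'\<close> are linked outside \<open>U\<close>\<close>
      define E' where "E' = insert (p, u') (insert (u', p) E)"
      have E': "sym E'" "irrefl E'"
        using E \<open>p \<noteq> u'\<close> by (auto simp: E'_def sym_def irrefl_def)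
      have "wheel E' (insert p U) UNIV"
      proof (rule wheel_if_degree_ge_3[OF _ E'])
        show "finite (insert p U)" using finU by simp
        show "insert p U - {p} \<noteq> {}" using pq \<open>p \<notin> U\<close> by auto
        fix v assume "v \<in> insert p U - {p}"
        then have v: "v \<in> U" "v \<in> H" using U by auto
        show "3 \<le> card (nbs E' (insert p U) v)"
        proof (cases "v = u'")
          case True
          \<comment> \<open>The vertex \<open>u'\<close> loses \<open>q\<close> but gains
            \<open>p\<close>, to which it was not adjacent before.\<close>
          have "nbs E H v \<subseteq> insert q (nbs E U v)"
            using nbsU[OF v(1)] Tpq only_u[OF v(1)] True \<open>u' \<noteq> u\<close> by (auto simp: nbs_def)
          then have "card (nbs E H v) \<le> card (insert q (nbs E U v))" using finU by (intro card_mono) auto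
          also have "\<dots> \<le> Suc (card (nbs E U v))" using finU by (simp add: card_insert_if)
          also have "\<dots> = card (insert p (nbs E U v))"
            using finU \<open>p \<notin> U\<close> by (simp add: nbs_def)
          also have "\<dots> \<le> card (nbs E' (insert p U) v)"
            using finU True by (intro card_mono) (auto simp: nbs_def E'_def)
          finally show ?thesis using deg[OF v(2)] by simp
        next
          case False
          then have "nbs E H v \<subseteq> nbs E' (insert p U) v"
            using nbsU[OF v(1)] Tpq only_u'[OF v(1)] by (auto simp: nbs_def E'_def)
          then have "card (nbs E H v) \<le> card (nbs E' (insert p U) v)" using finU by (intro card_mono) auto
          then show ?thesis using deg[OF v(2)] by simp
        qed
      qed
      \<comment> \<open>Suppressing \<open>p\<close> gives a wheel in \<open>U\<close> with the
        extra edge between \<open>u\<close> and \<open>u'\<close>. That edge is then replaced by the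
        cycle minus a third vertex \<open>c\<close>, so the wheel avoids \<open>c\<close>.\<close>
      define F where "F = insert (u, u') (insert (u', u) E')"
      have "nbs E' (insert p U) p \<subseteq> {u, u'}"
        using only_u sym irr \<open>p \<noteq> u'\<close> by (auto simp: nbs_def E'_def)
      moreover from this have "card (nbs E' (insert p U) p) \<le> card {u, u'}" by (intro card_mono) auto
      moreover have "card {u, u'} \<le> 2" by (simp add: card_insert_if)
      ultimately have "wheel F (insert p U - {p}) UNIV"
        by (intro wheel_suppress[OF _ E' \<open>wheel E' (insert p U) UNIV\<close>])
          (use finU in \<open>auto simp: F_def\<close>)
      then have "wheel (insert (u, u') (insert (u', u) E)) U UNIV"
        by (rule wheel_mono) (use \<open>p \<notin> U\<close> in \<open>auto simp: F_def E'_def\<close>)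
      moreover have "\<not> C \<subseteq> {p, q}" using c3 card_mono[of "{p, q}" C] \<open>p \<noteq> q\<close> by auto
      then obtain c where c: "c \<in> C" "c \<noteq> p" "c \<noteq> q" by blast
      have "conn E (C - {c})" using conn_cycle_minus[OF E(1) cs(1)] c by (simp add: C_def)
      moreover have "p \<in> nbs E (C - {c}) u" "q \<in> nbs E (C - {c}) u'"
        using pq c \<open>p \<in> C\<close> \<open>q \<in> C\<close> by (auto simp: nbs_def)
      ultimately have "wheel E (U \<union> (C - {c})) UNIV"
        using U \<open>u' \<noteq> u\<close> by (intro wheel_subdivide[OF E(1), of _ u u']) auto
      then have "wheel E (H - {c}) UNIV" by (rule wheel_mono) (use U C c in auto)
      then show False using crit c C by blast
    qed
  qed
  then show ?thesis
    using cs C U connU unfolding T_def C_def by (intro wheel_cycle[OF E(1) cs(1)])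
qed

text \<open>
  By induction, suppressing a vertex of degree 2: its two neighbours are nonadjacent, since otherwise
  the wheel could avoid that vertex.
\<close>

lemma wheel_critical:
  assumes "finite H" "sym E" "irrefl E" "N \<subseteq> H" "N \<noteq> {}" "wheel E H UNIV"
    and "\<And>x. x \<in> N \<Longrightarrow> \<not> wheel E (H - {x}) UNIV"
    and "\<And>v. v \<in> H - N \<Longrightarrow> 4 \<le> card (nbs E H v)"
  shows "wheel E H N"
  using assms
proof (induction "card H" arbitrary: E H N rule: less_induct)
  case (less H E N)
  note fin = less.prems(1) and E = less.prems(2,3) and N = less.prems(4,5)
    and wheel = less.prems(6) and crit = less.prems(7) and deg = less.prems(8)
  have irr: "(u, u) \<notin> E" for u using E(2) by (auto simp: irrefl_def)
  have sym: "(v, u) \<in> E" if "(u, v) \<in> E" for u v using E(1) that by (auto dest: symD)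
  show ?case
  proof (cases "\<exists>d\<in>H. card (nbs E H d) \<le> 2")
    case True
    then obtain d where d: "d \<in> H" "card (nbs E H d) \<le> 2" by blast
    have "d \<in> N" using deg[of d] d by auto
    obtain y z where yz: "y \<in> nbs E H d" "z \<in> nbs E H d" "y \<noteq> z" "(y, z) \<notin> E"
      using wheel_suppress[OF fin E wheel d(2), of E] crit[OF \<open>d \<in> N\<close>] by blast
    then have "(z, y) \<notin> E" using sym by blast
    have nd: "nbs E H d = {y, z}"
      using card_seteq[of "nbs E H d" "{y, z}"] yz d fin by auto
    have "y \<noteq> d" "z \<noteq> d" "(y, d) \<in> E" "(z, d) \<in> E" "y \<in> H" "z \<in> H"
      using yz irr sym by (auto simp: nbs_def)
    define F where "F = insert (y, z) (insert (z, y) E)"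
    \<comment> \<open>This undoes the suppression: \<open>d\<close> subdivides the added
      edge.\<close>
    have subdiv: "wheel E (insert d X) M" if "wheel F X M" "d \<notin> X" for X M
      using wheel_subdivide[OF E(1), of "{d}" y z X M] that yz \<open>(y, d) \<in> E\<close> \<open>(z, d) \<in> E\<close>
      by (auto simp: F_def nbs_def)
    \<comment> \<open>The induction needs an element of \<open>N\<close> besides \<open>d\<close>.
      As \<open>H - {d}\<close> has no wheel, some vertex has degree at most 2 in it, hence at most
      3 in \<open>H\<close>.\<close>
    obtain v where v: "v \<in> H - {d}" "\<not> 3 \<le> card (nbs E (H - {d}) v)"
      using wheel_if_degree_ge_3[OF _ E, of "H - {d}" d] crit[OF \<open>d \<in> N\<close>] fin \<open>y \<in> H\<close> \<open>y \<noteq> d\<close> by blast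
    then have "\<not> 4 \<le> card (nbs E H v)" using card_nbs_remove[OF fin, of E v d] by linarith
    then have "v \<in> N - {d}" using deg[of v] v by blast
    have "wheel F (H - {d}) (N - {d})"
    proof (rule less.hyps)
      show "card (H - {d}) < card H" using fin d(1) by (rule card_Diff1_less)
      show "sym F" "irrefl F" using E yz by (auto simp: F_def sym_def irrefl_def)
      show "wheel F (H - {d}) UNIV"
        by (rule wheel_suppress[OF fin E wheel d(2)]) (use nd in \<open>auto simp: F_def\<close>)
      show "\<not> wheel F (H - {d} - {x}) UNIV" if "x \<in> N - {d}" for x
      proof
        assume "wheel F (H - {d} - {x}) UNIV"
        from subdiv[OF this] have "wheel E (H - {x}) UNIV"
          using d that by (metis Diff_iff insertI1 insert_Diff insert_Diff_if insert_Diff_single singletonD)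
        then show False using crit that by blast
      qed
      fix v assume "v \<in> H - {d} - (N - {d})"
      then have v: "v \<in> H - N" "v \<noteq> d" by auto
      \<comment> \<open>Each of \<open>y\<close>, \<open>z\<close> loses the neighbour
        \<open>d\<close> but gains the other one, which was not adjacent to it.\<close>
      have new: "4 \<le> card (nbs F (H - {d}) v)" if "s \<in> H" "s \<noteq> d" "(v, s) \<in> F" "(v, s) \<notin> E" for s
      proof -
        have "4 \<le> card (nbs E H v)" using deg v by blast
        also have "\<dots> \<le> Suc (card (nbs E (H - {d}) v))" using card_nbs_remove[OF fin, of E v d] by linarith
        also have "\<dots> = card (insert s (nbs E (H - {d}) v))" using fin that by (simp add: nbs_def)
        also have "\<dots> \<le> card (nbs F (H - {d}) v)"
          using fin that by (intro card_mono) (auto simp: nbs_def F_def)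
        finally show ?thesis .
      qed
      consider "v = y" | "v = z" | "v \<notin> nbs E H d" using nd by blast
      then show "4 \<le> card (nbs F (H - {d}) v)"
      proof cases
        case 1
        then show ?thesis using new[of z] yz \<open>z \<noteq> d\<close> \<open>z \<in> H\<close> by (simp add: F_def)
      next
        case 2
        then show ?thesis using new[of y] \<open>(z, y) \<notin> E\<close> \<open>y \<noteq> d\<close> \<open>y \<in> H\<close> by (simp add: F_def)
      next
        case 3
        then have "nbs E H v \<subseteq> nbs F (H - {d}) v" using v sym by (auto simp: nbs_def F_def)
        then have "card (nbs E H v) \<le> card (nbs F (H - {d}) v)" using fin by (intro card_mono) auto
        then show ?thesis using deg[OF v(1)] by simp
      qed
    qed (use fin N \<open>v \<in> N - {d}\<close> in auto)
    from subdiv[OF this] have "wheel E H (N - {d})" using d by (simp add: insert_absorb)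
    then show ?thesis by (rule wheel_mono) auto
  next
    case False
    then have ge3: "3 \<le> card (nbs E H v)" if "v \<in> H" for v using that by force
    obtain x where "x \<in> N" using N by blast
    have sub: "{v \<in> H. card (nbs E H v) = 3} \<subseteq> N" using deg by fastforce
    have "wheel E H {v \<in> H. card (nbs E H v) = 3}"
      by (rule wheel_degree_3[OF fin E ge3 refl, of x]) (use crit sub N \<open>x \<in> N\<close> in auto)
    then show ?thesis by (rule wheel_mono) (use sub in auto)
  qed
qed

section \<open>From wheels to subdivisions\<close>

definition path_list :: "'a rel \<Rightarrow> 'a list \<Rightarrow> bool" where
  "path_list E xs \<longleftrightarrow> distinct xs \<and> successively (\<lambda>u v. (u, v) \<in> E) xs"

lemma path_list_rev: "sym E \<Longrightarrow> path_list E xs \<Longrightarrow> path_list E (rev xs)"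
  unfolding path_list_def by (auto elim!: successively_mono dest: symD)

lemma path_list_appendD: "path_list E (xs @ ys) \<Longrightarrow> path_list E xs"
  by (auto simp: path_list_def successively_append_iff)

lemma linked_path_list:
  assumes "linked E X u v" "u \<in> X"
  obtains xs where "path_list E xs" "xs \<noteq> []" "hd xs = u" "last xs = v" "set xs \<subseteq> X"
proof -
  have "\<exists>xs. path_list E xs \<and> xs \<noteq> [] \<and> hd xs = u \<and> last xs = v \<and> set xs \<subseteq> X"
    using assms(1)[unfolded linked_def]
  proof (induction rule: rtrancl_induct)
    case base
    show ?case using assms(2) by (intro exI[of _ "[u]"]) (auto simp: path_list_def)
  next
    case (step v w)
    then obtain xs where xs: "path_list E xs" "xs \<noteq> []" "hd xs = u" "last xs = v" "set xs \<subseteq> X" by blast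
    show ?case
    proof (cases "w \<in> set xs")
      case True
      then obtain ys zs where "xs = (ys @ [w]) @ zs" by (metis append.assoc append_Cons append_Nil split_list)
      moreover from this have "path_list E (ys @ [w])" using xs path_list_appendD by metis
      ultimately show ?thesis using xs by (intro exI[of _ "ys @ [w]"]) (auto simp: hd_append)
    next
      case False
      with xs step show ?thesis
        by (intro exI[of _ "xs @ [w]"]) (auto simp: path_list_def successively_append_iff)
    qed
  qed
  then show thesis using that by blast
qed

lemma linked_inner_path:
  assumes "linked E (X \<union> {u, v}) u v" "u \<noteq> v"
  obtains xs where "path_list E (u # xs @ [v])" "set xs \<subseteq> X"
proof -
  obtain ys where ys: "path_list E ys" "ys \<noteq> []" "hd ys = u" "last ys = v" "set ys \<subseteq> X \<union> {u, v}"
    using assms by (auto elim: linked_path_list)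
  then obtain zs where zs: "ys = u # zs" by (cases ys) auto
  then have "zs \<noteq> []" using ys assms(2) by auto
  then obtain xs where xs: "zs = xs @ [v]" using ys zs by (metis append_butlast_last_id last_ConsR)
  have "set xs \<subseteq> X" using ys unfolding zs xs by (auto simp: path_list_def)
  then show thesis using that[of xs] ys zs xs by simp
qed

text \<open>Follow a path in \<open>U\<close> from a neighbour of \<open>c\<close> until it first
  meets a path between neighbours of \<open>a\<close> and \<open>b\<close>; the meeting vertex is
  the centre \<open>u\<close>. This resolves a blown-up hub into a branch vertex with three
  legs.\<close>

lemma tripod:
  assumes E: "sym E" and U: "conn E U" and nbs: "nbs E U a \<noteq> {}" "nbs E U b \<noteq> {}" "nbs E U c \<noteq> {}"
    and out: "a \<notin> U" "b \<notin> U" "c \<notin> U"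
  obtains u xs ys zs where "path_list E (u # xs @ [a])" "path_list E (u # ys @ [b])" "path_list E (u # zs @ [c])"
    "distinct (u # xs @ ys @ zs)" "set (u # xs @ ys @ zs) \<subseteq> U"
proof -
  obtain a' b' c' where abc: "a' \<in> U" "(a', a) \<in> E" "b' \<in> U" "(b', b) \<in> E" "c' \<in> U" "(c', c) \<in> E"
    using nbs E by (auto simp: nbs_def dest: symD)
  have "linked E U a' b'" "linked E U c' a'" using U abc by (auto simp: conn_def)
  then obtain ps qs where ps: "path_list E ps" "ps \<noteq> []" "hd ps = a'" "last ps = b'" "set ps \<subseteq> U"
    and qs: "path_list E qs" "qs \<noteq> []" "hd qs = c'" "last qs = a'" "set qs \<subseteq> U"
    using abc by (metis linked_path_list)
  have "\<exists>x\<in>set qs. x \<in> set ps" using ps qs by (metis hd_in_set last_in_set)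
  then obtain q1 u q2 where q: "qs = q1 @ u # q2" "u \<in> set ps" "\<forall>x\<in>set q1. x \<notin> set ps"
    by (rule split_list_first_propE)
  obtain p1 p2 where p: "ps = p1 @ u # p2" using q(2) by (meson split_list)
  have "path_list E (a # p1 @ [u])"
    using ps abc E out unfolding p by (auto simp: path_list_def successively_append_iff successively_Cons hd_append dest: symD)
  from path_list_rev[OF E this] have "path_list E (u # rev p1 @ [a])" by simp
  moreover have "path_list E (u # p2 @ [b])"
    using ps abc E out unfolding p by (auto simp: path_list_def successively_append_iff successively_Cons hd_append split: if_splits)
  moreover have "path_list E (c # q1 @ [u])"
    using qs abc E out unfolding q by (auto simp: path_list_def successively_append_iff successively_Cons hd_append dest: symD split: if_splits)
  from path_list_rev[OF E this] have "path_list E (u # rev q1 @ [c])" by simp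
  moreover have "distinct (u # rev p1 @ p2 @ rev q1)" "set (u # rev p1 @ p2 @ rev q1) \<subseteq> U"
    using ps qs q unfolding p by (auto simp: path_list_def)
  ultimately show thesis by (rule that)
qed

section \<open>Graphs composed of paths\<close>

fun list_arcs :: "'a list \<Rightarrow> 'a rel" where
  "list_arcs (x # y # xs) = {(x, y), (y, x)} \<union> list_arcs (y # xs)"
| "list_arcs xs = {}"

text \<open>Indexing by paths makes subdividing an edge the replacement of one list
  \<open>[p, q]\<close> by a longer one.\<close>

definition path_graph :: "'a list set \<Rightarrow> 'a pair_pre_digraph" where
  "path_graph L = \<lparr>pverts = \<Union>(set ` L), parcs = \<Union>(list_arcs ` L)\<rparr>"

lemma list_arcs_subset: "list_arcs xs \<subseteq> set xs \<times> set xs"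
  by (induction xs rule: list_arcs.induct) auto

lemma list_arcs_subset_rel: "sym E \<Longrightarrow> successively (\<lambda>u v. (u, v) \<in> E) xs \<Longrightarrow> list_arcs xs \<subseteq> E"
  by (induction xs rule: list_arcs.induct) (auto dest: symD)

text \<open>If there are inner vertices, every arc touches one of them; so the path is the single
  edge.\<close>

lemma list_arcs_ends:
  assumes "distinct (p # xs @ [q])" "(u, v) \<in> list_arcs (p # xs @ [q])" "u \<notin> set xs" "v \<notin> set xs"
  shows "{u, v} = {p, q}"
proof (cases xs)
  case (Cons x ys)
  have "list_arcs (y # zs @ [r]) \<subseteq> (set (y # zs) \<times> UNIV) \<union> (UNIV \<times> set (y # zs))" for y r :: 'a and zs
    by (induction zs arbitrary: y) auto
  from this[of x ys q] show ?thesis using assms Cons by auto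
qed (use assms in auto)

text \<open>Insert the first inner vertex \<open>x\<close>, move \<open>[p, x]\<close> to
  \<open>L\<close>, and continue with the edge from \<open>x\<close> to \<open>q\<close>. A
  subdivision step deletes the edge from the whole graph, hence no list in \<open>L\<close> may
  contain it.\<close>

lemma subdivision_path_graph:
  assumes "subdivision_pair K (path_graph (insert [p, q] L))"
    and "distinct (p # xs @ [q])" "set xs \<inter> \<Union>(set ` L) = {}" "(p, q) \<notin> \<Union>(list_arcs ` L)" "(q, p) \<notin> \<Union>(list_arcs ` L)"
  shows "subdivision_pair K (path_graph (insert (p # xs @ [q]) L))"
  using assms
proof (induction xs arbitrary: p L)
  case (Cons x xs)
  let ?H = "path_graph (insert [p, q] L)"
  have x: "x \<notin> \<Union>(set ` L)" "x \<noteq> p" "x \<noteq> q" using Cons.prems by auto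
  have "list_arcs ys \<subseteq> (UNIV - {x}) \<times> (UNIV - {x})" if "ys \<in> L" for ys
    using list_arcs_subset[of ys] x that by blast
  then have nx: "(x, u) \<notin> \<Union>(list_arcs ` L)" "(u, x) \<notin> \<Union>(list_arcs ` L)" for u by blast+
  have "subdivision_pair K (subdivide ?H (p, q) x)"
    by (rule subdivision_pair_divide[OF _ _ Cons.prems(1)]) (use x in \<open>auto simp: path_graph_def\<close>)
  moreover have "subdivide ?H (p, q) x = path_graph (insert [x, q] (insert [p, x] L))"
    unfolding path_graph_def subdivide.simps using Cons.prems(4,5) by auto
  ultimately have "subdivision_pair K (path_graph (insert (x # xs @ [q]) (insert [p, x] L)))"
    using Cons.prems x nx by (intro Cons.IH) auto
  moreover have "path_graph (insert (x # xs @ [q]) (insert [p, x] L)) = path_graph (insert (p # (x # xs) @ [q]) L)"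
    by (auto simp: path_graph_def)
  ultimately show ?case by simp
qed simp

text \<open>A triple holds the ends of an edge and the inner vertices to be put on it. Edges are
  expanded one at a time; \<open>L\<close> collects the finished paths and \<open>B\<close> contains
  the branch vertices.\<close>

lemma subdivision_path_graphs:
  fixes ts :: "('a \<times> 'a list \<times> 'a) list"
  defines "edge \<equiv> \<lambda>(p, xs, q). [p, q]" and "path \<equiv> \<lambda>(p, xs, q). p # xs @ [q]"
  assumes "subdivision_pair K (path_graph (edge ` set ts \<union> L))"
    and "\<And>p xs q. (p, xs, q) \<in> set ts \<Longrightarrow> p \<in> B \<and> q \<in> B \<and> distinct (p # xs @ [q]) \<and>
      set xs \<inter> (B \<union> \<Union>(set ` L)) = {} \<and> (p, q) \<notin> \<Union>(list_arcs ` L) \<and> (q, p) \<notin> \<Union>(list_arcs ` L)"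
    and "distinct (concat (map (fst \<circ> snd) ts))" and "distinct (map (\<lambda>(p, xs, q). {p, q}) ts)"
  shows "subdivision_pair K (path_graph (path ` set ts \<union> L))"
  using assms(3-)
proof (induction ts arbitrary: L)
  case (Cons t ts)
  obtain p xs q where t: "t = (p, xs, q)" by (cases t) auto
  note prem = Cons.prems(2)
  have pq: "p \<in> B" "q \<in> B" "distinct (p # xs @ [q])" "set xs \<inter> B = {}" "set xs \<inter> \<Union>(set ` L) = {}"
    "(p, q) \<notin> \<Union>(list_arcs ` L)" "(q, p) \<notin> \<Union>(list_arcs ` L)"
    using prem[of p xs q] t by auto
  have neq: "{p, q} \<noteq> {p', q'}" if "(p', ys, q') \<in> set ts" for p' ys q'
    using Cons.prems(4) that t by force
  have disj: "set xs \<inter> set ys = {}" if "(p', ys, q') \<in> set ts" for p' ys q'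
    using Cons.prems(3) that t by force
  have "edge ` set (t # ts) \<union> L = insert [p, q] (edge ` set ts \<union> L)" by (simp add: t edge_def)
  then have "subdivision_pair K (path_graph (insert [p, q] (edge ` set ts \<union> L)))"
    using Cons.prems(1) by simp
  then have "subdivision_pair K (path_graph (insert (p # xs @ [q]) (edge ` set ts \<union> L)))"
  proof (rule subdivision_path_graph)
    show "set xs \<inter> \<Union>(set ` (edge ` set ts \<union> L)) = {}"
      using pq(4,5) prem by (fastforce simp: edge_def)
    show "(p, q) \<notin> \<Union>(list_arcs ` (edge ` set ts \<union> L))" "(q, p) \<notin> \<Union>(list_arcs ` (edge ` set ts \<union> L))"
      using pq(6,7) neq by (fastforce simp: edge_def doubleton_eq_iff)+
  qed (use pq in auto)
  then have "subdivision_pair K (path_graph (edge ` set ts \<union> insert (path t) L))"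
    by (simp add: t path_def)
  then have "subdivision_pair K (path_graph (path ` set ts \<union> insert (path t) L))"
  proof (rule Cons.IH)
    fix p' ys q' assume t': "(p', ys, q') \<in> set ts"
    have *: "p' \<in> B \<and> q' \<in> B \<and> distinct (p' # ys @ [q']) \<and>
      set ys \<inter> (B \<union> \<Union>(set ` L)) = {} \<and> (p', q') \<notin> \<Union>(list_arcs ` L) \<and> (q', p') \<notin> \<Union>(list_arcs ` L)"
      using prem[of p' ys q'] t' by simp
    moreover have "(u, v) \<notin> list_arcs (p # xs @ [q])" if "{u, v} = {p', q'}" for u v
    proof
      assume "(u, v) \<in> list_arcs (p # xs @ [q])"
      moreover have "u \<notin> set xs" "v \<notin> set xs" using that * pq(4) by (auto simp: doubleton_eq_iff)
      ultimately show False using list_arcs_ends[OF pq(3)] neq[OF t'] that by metis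
    qed
    ultimately show "p' \<in> B \<and> q' \<in> B \<and> distinct (p' # ys @ [q']) \<and>
      set ys \<inter> (B \<union> \<Union>(set ` insert (path t) L)) = {} \<and>
      (p', q') \<notin> \<Union>(list_arcs ` insert (path t) L) \<and> (q', p') \<notin> \<Union>(list_arcs ` insert (path t) L)"
      using disj[OF t'] pq(1,2) by (auto simp: t path_def)
  qed (use Cons.prems in auto)
  then show ?case by simp
qed simp

text \<open>The missing edge joins \<open>u\<close> and \<open>v\<close>, which will be the centres
  of the two hubs.\<close>

lemma complete_minus_edge_5I:
  assumes "distinct [a, b, c, u, v]"
  shows "complete_minus_edge 5 (path_graph {[b, c], [a, c], [a, b], [u, a], [u, b], [u, c], [v, a], [v, b], [v, c]})"
proof -
  define P where "P = {a, b, c, u, v}"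
  define C where "C = \<lparr>pverts = P, parcs = {(x, y). (x, y) \<in> P \<times> P \<and> x \<noteq> y}\<rparr>"
  have "card P = 5" using assms by (simp add: P_def)
  then have "K\<^bsub>5\<^esub> (with_proj C)"
    unfolding complete_digraph_pair_def C_def by (simp add: P_def)
  moreover have "(u, v) \<in> parcs C" using assms by (simp add: C_def P_def)
  moreover have "path_graph {[b, c], [a, c], [a, b], [u, a], [u, b], [u, c], [v, a], [v, b], [v, c]} = delete_edge C u v"
  proof (rule pair_pre_digraph.equality)
    let ?L = "{[b, c], [a, c], [a, b], [u, a], [u, b], [u, c], [v, a], [v, b], [v, c]}"
    show "parcs (path_graph ?L) = parcs (delete_edge C u v)"
    proof
      show "parcs (path_graph ?L) \<subseteq> parcs (delete_edge C u v)"
        using assms by (auto simp: path_graph_def delete_edge_def C_def P_def)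
      show "parcs (delete_edge C u v) \<subseteq> parcs (path_graph ?L)"
      proof (rule subrelI)
        fix x y assume "(x, y) \<in> parcs (delete_edge C u v)"
        then have "x \<in> P" "y \<in> P" "x \<noteq> y" "(x, y) \<noteq> (u, v)" "(x, y) \<noteq> (v, u)"
          by (simp_all add: delete_edge_def C_def)
        then show "(x, y) \<in> parcs (path_graph ?L)"
          unfolding P_def by (elim insertE emptyE; simp add: path_graph_def)
      qed
    qed
  qed (auto simp: path_graph_def delete_edge_def C_def P_def)
  ultimately show ?thesis unfolding complete_minus_edge_def by blast
qed

lemma pair_bidirected_digraph_path_graph:
  assumes "\<And>xs. xs \<in> L \<Longrightarrow> distinct xs"
  shows "pair_bidirected_digraph (path_graph L)"
proof
  have sub: "list_arcs xs \<subseteq> set xs \<times> set xs" for xs :: "'a list" by (rule list_arcs_subset)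
  show "fst e \<in> pverts (path_graph L)" "snd e \<in> pverts (path_graph L)" if "e \<in> parcs (path_graph L)" for e
    using that sub by (fastforce simp: path_graph_def)+
  have "(y, x) \<in> list_arcs xs" if "(x, y) \<in> list_arcs xs" for x y and xs :: "'a list"
    using that by (induction xs rule: list_arcs.induct) auto
  then show "symmetric (with_proj (path_graph L))"
    by (auto simp: symmetric_def sym_def path_graph_def)
  have "x \<noteq> y" if "(x, y) \<in> list_arcs xs" "distinct xs" for x y and xs :: "'a list"
    using that by (induction xs rule: list_arcs.induct) auto
  then show "fst e \<noteq> snd e" if "e \<in> parcs (path_graph L)" for e
    using that assms by (cases e) (auto simp: path_graph_def)
qed

lemma subgraph_path_graph:
  assumes "pair_graph G" and "\<And>xs. xs \<in> L \<Longrightarrow> path_list (parcs G) xs \<and> set xs \<subseteq> pverts G"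
  shows "subgraph (with_proj (path_graph L)) (with_proj G)"
proof (rule subgraphI)
  interpret G: pair_graph G by fact
  show "wf_digraph (with_proj G)" by unfold_locales
  interpret P: pair_bidirected_digraph "path_graph L"
    using assms(2) by (intro pair_bidirected_digraph_path_graph) (auto simp: path_list_def)
  show "wf_digraph (with_proj (path_graph L))" by unfold_locales
  have "sym (parcs G)" using G.arcs_symmetric by (auto simp: sym_def)
  then show "arcs (with_proj (path_graph L)) \<subseteq> arcs (with_proj G)"
    using assms(2) list_arcs_subset_rel[of "parcs G"] by (fastforce simp: path_graph_def path_list_def)
  show "verts (with_proj (path_graph L)) \<subseteq> verts (with_proj G)"
    using assms(2) by (auto simp: path_graph_def)
qed auto

text \<open>The set \<open>V\<close> acts as a second hub. The rim paths subdivide the triangle on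
  \<open>a\<close>, \<open>b\<close>, \<open>c\<close>, and tripods in \<open>U\<close> and
  \<open>V\<close> join two further branch vertices to it.\<close>

lemma contains_K5_minus_if_wheel:
  assumes G: "pair_graph G" and w: "wheel_at (parcs G) H a b c A B C U"
    and V: "conn (parcs G) V" "V \<inter> H = {}" "V \<union> H \<subseteq> pverts G"
    and nbs: "nbs (parcs G) V a \<noteq> {}" "nbs (parcs G) V b \<noteq> {}" "nbs (parcs G) V c \<noteq> {}"
  shows "contains_subdivision_of (complete_minus_edge 5) G"
proof -
  interpret G: pair_graph G by fact
  let ?E = "parcs G"
  have E: "sym ?E" using G.arcs_symmetric by (auto simp: sym_def)
  note w = w[unfolded wheel_at_def]
  have "a \<noteq> b" "b \<noteq> c" "a \<noteq> c" using w by - ((elim conjE, assumption)+)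
  have sub: "{a, b, c} \<union> A \<union> B \<union> C \<union> U \<subseteq> H" and disj: "{a, b, c} \<inter> (A \<union> B \<union> C \<union> U) = {}"
    "A \<inter> B = {}" "A \<inter> C = {}" "B \<inter> C = {}" "U \<inter> (A \<union> B \<union> C) = {}"
    and link: "linked ?E (A \<union> {b, c}) b c" "linked ?E (B \<union> {a, c}) a c" "linked ?E (C \<union> {a, b}) a b"
    and U: "conn ?E U" "nbs ?E U a \<noteq> {}" "nbs ?E U b \<noteq> {}" "nbs ?E U c \<noteq> {}"
    using w by - ((elim conjE, assumption)+)
  obtain xs where xs: "path_list ?E (b # xs @ [c])" "set xs \<subseteq> A"
    using linked_inner_path[OF link(1) \<open>b \<noteq> c\<close>] by blast
  obtain ys where ys: "path_list ?E (a # ys @ [c])" "set ys \<subseteq> B"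
    using linked_inner_path[OF link(2) \<open>a \<noteq> c\<close>] by blast
  obtain zs where zs: "path_list ?E (a # zs @ [b])" "set zs \<subseteq> C"
    using linked_inner_path[OF link(3) \<open>a \<noteq> b\<close>] by blast
  have "a \<notin> U" "b \<notin> U" "c \<notin> U" using disj(1) by blast+
  from tripod[OF E U this] obtain u u1 u2 u3 where
    u: "path_list ?E (u # u1 @ [a])" "path_list ?E (u # u2 @ [b])" "path_list ?E (u # u3 @ [c])"
    "distinct (u # u1 @ u2 @ u3)" "set (u # u1 @ u2 @ u3) \<subseteq> U" by blast
  have "a \<notin> V" "b \<notin> V" "c \<notin> V" using V(2) sub by blast+
  from tripod[OF E V(1) nbs this] obtain v v1 v2 v3 where
    v: "path_list ?E (v # v1 @ [a])" "path_list ?E (v # v2 @ [b])" "path_list ?E (v # v3 @ [c])"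
    "distinct (v # v1 @ v2 @ v3)" "set (v # v1 @ v2 @ v3) \<subseteq> V" by blast
  \<comment> \<open>Three edges along the rim, three legs through \<open>U\<close> and three through
    \<open>V\<close>, each with its inner vertices.\<close>
  define ts where "ts = [(b, xs, c), (a, ys, c), (a, zs, b), (u, u1, a), (u, u2, b), (u, u3, c),
    (v, v1, a), (v, v2, b), (v, v3, c)]"
  define K where "K = path_graph {[b, c], [a, c], [a, b], [u, a], [u, b], [u, c], [v, a], [v, b], [v, c]}"
  define L where "L = (\<lambda>(p, xs, q). p # xs @ [q]) ` set ts"
  have VU: "V \<inter> (A \<union> B \<union> C \<union> U) = {}" using V(2) sub by blast
  have "u \<in> U" "v \<in> V" using u v by auto
  have dist: "distinct [a, b, c, u, v]"
    using \<open>a \<noteq> b\<close> \<open>b \<noteq> c\<close> \<open>a \<noteq> c\<close> \<open>u \<in> U\<close> \<open>v \<in> V\<close> \<open>a \<notin> U\<close> \<open>b \<notin> U\<close> \<open>c \<notin> U\<close>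
      \<open>a \<notin> V\<close> \<open>b \<notin> V\<close> \<open>c \<notin> V\<close> VU by auto
  have paths: "path_list ?E (p # l @ [q]) \<and> p \<in> {a, b, c, u, v} \<and> q \<in> {a, b, c, u, v} \<and>
      set l \<inter> {a, b, c, u, v} = {} \<and> set l \<subseteq> V \<union> H" if "(p, l, q) \<in> set ts" for p l q
  proof -
    have lA: "set l \<inter> {a, b, c, u, v} = {} \<and> set l \<subseteq> V \<union> H" if "set l \<subseteq> A \<union> B \<union> C"
      using that disj(1,5) VU \<open>u \<in> U\<close> \<open>v \<in> V\<close> sub by blast
    have lU: "set l \<inter> {a, b, c, u, v} = {} \<and> set l \<subseteq> V \<union> H" if "set l \<subseteq> U" "u \<notin> set l"
      using that disj(1) VU \<open>v \<in> V\<close> sub by blast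
    have lV: "set l \<inter> {a, b, c, u, v} = {} \<and> set l \<subseteq> V \<union> H" if "set l \<subseteq> V" "v \<notin> set l"
      using that VU \<open>u \<in> U\<close> \<open>a \<notin> V\<close> \<open>b \<notin> V\<close> \<open>c \<notin> V\<close> by blast
    have "set l \<subseteq> A \<union> B \<union> C \<or> (set l \<subseteq> U \<and> u \<notin> set l) \<or> (set l \<subseteq> V \<and> v \<notin> set l)"
      using that xs(2) ys(2) zs(2) u(4,5) v(4,5) unfolding ts_def by auto
    moreover have "path_list ?E (p # l @ [q])" "p \<in> {a, b, c, u, v}" "q \<in> {a, b, c, u, v}"
      using that xs(1) ys(1) zs(1) u(1-3) v(1-3) unfolding ts_def by auto
    ultimately show ?thesis using lA lU lV by blast
  qed
  have "complete_minus_edge 5 K" unfolding K_def using dist by (rule complete_minus_edge_5I)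
  moreover have "subgraph (with_proj (path_graph L)) (with_proj G)"
  proof (rule subgraph_path_graph[OF G])
    fix l assume "l \<in> L"
    then obtain p l' q where l: "l = p # l' @ [q]" "(p, l', q) \<in> set ts" by (auto simp: L_def)
    have "{a, b, c, u, v} \<subseteq> V \<union> H" using sub \<open>u \<in> U\<close> \<open>v \<in> V\<close> by blast
    then have "p \<in> V \<union> H" "q \<in> V \<union> H" "set l' \<subseteq> V \<union> H" using paths[OF l(2)] by blast+
    then show "path_list ?E l \<and> set l \<subseteq> pverts G" using paths[OF l(2)] V(3) by (simp add: l(1)) blast
  qed
  moreover have "subdivision_pair K (path_graph L)"
  proof -
    have "pair_bidirected_digraph K"
      unfolding K_def using dist by (intro pair_bidirected_digraph_path_graph) auto
    then have "subdivision_pair K (path_graph ((\<lambda>(p, xs, q). [p, q]) ` set ts \<union> {}))"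
      using subdivision_pair_base[of K] by (simp add: K_def ts_def)
    then have "subdivision_pair K (path_graph ((\<lambda>(p, xs, q). p # xs @ [q]) ` set ts \<union> {}))"
    proof (rule subdivision_path_graphs[where B = "{a, b, c, u, v}"])
      have "distinct (xs @ ys @ zs)"
        using xs ys zs disj(2-4) by (auto simp: path_list_def)
      moreover have "distinct (u1 @ u2 @ u3)" "distinct (v1 @ v2 @ v3)" using u(4) v(4) by simp_all
      moreover have "set (xs @ ys @ zs) \<subseteq> A \<union> B \<union> C" "set (u1 @ u2 @ u3) \<subseteq> U" "set (v1 @ v2 @ v3) \<subseteq> V"
        using xs ys zs u v by auto
      then have "set (xs @ ys @ zs) \<inter> set ((u1 @ u2 @ u3) @ (v1 @ v2 @ v3)) = {}"
        "set (u1 @ u2 @ u3) \<inter> set (v1 @ v2 @ v3) = {}"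
        using disj(5) VU unfolding set_append by blast+
      ultimately have "distinct ((xs @ ys @ zs) @ (u1 @ u2 @ u3) @ (v1 @ v2 @ v3))"
        by (simp only: distinct_append)
      then show "distinct (concat (map (fst \<circ> snd) ts))" by (simp add: ts_def)
      show "distinct (map (\<lambda>(p, xs, q). {p, q}) ts)"
        using dist unfolding ts_def by (auto simp: doubleton_eq_iff)
    qed (use paths in \<open>auto simp: path_list_def\<close>)
    then show ?thesis by (simp add: L_def)
  qed
  ultimately show ?thesis unfolding contains_subdivision_of_def by blast
qed

section \<open>Connectivity and degrees of the given graph\<close>

lemma linked_if_connected:
  assumes "pair_graph G" "connected (with_proj G \<restriction> Y)" "v \<in> Y" "w \<in> Y"
  shows "linked (parcs G) Y v w"
proof -
  interpret G: pair_graph G by fact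
  let ?S = "mk_symmetric (with_proj G \<restriction> Y)"
  have "v \<rightarrow>\<^sup>*\<^bsub>with_proj ?S\<^esub> w"
    using assms(2-4) unfolding connected_def strongly_connected_def by simp
  then have "(v, w) \<in> (parcs ?S)\<^sup>*" by (metis reachable_rtranclI with_proj_simps(3))
  \<comment> \<open>Connectedness refers to the symmetric closure, which adds nothing to symmetric
    arcs.\<close>
  moreover have "parcs ?S \<subseteq> Restr (parcs G) Y"
    using G.arcs_symmetric by (auto simp: parcs_mk_symmetric induce_subgraph_def)
  ultimately show ?thesis unfolding linked_def by (meson rtrancl_mono subsetD)
qed

text \<open>Deleting fewer than \<open>k\<close> neighbours would isolate \<open>v\<close>, while a
  vertex \<open>w\<close> remains because there are more than \<open>k\<close> vertices.\<close>

lemma degree_ge_if_k_connected: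
  assumes G: "pair_graph G" and k: "k_connected k G" and v: "v \<in> pverts G"
  shows "k \<le> card (nbs (parcs G) (pverts G) v)"
proof (rule ccontr)
  interpret G: pair_graph G by fact
  let ?X = "nbs (parcs G) (pverts G) v"
  assume X: "\<not> k \<le> card ?X"
  have sub: "?X \<subseteq> pverts G" "v \<notin> ?X" using G.no_loops' by (auto simp: nbs_def)
  have fin: "finite ?X" "finite (pverts G)" by simp_all
  have "card (insert v ?X) < card (pverts G)"
    using X k sub(2) fin by (simp add: k_connected_def)
  then have "\<not> pverts G \<subseteq> insert v ?X" using card_mono[of "insert v ?X" "pverts G"] fin by auto
  then obtain w where w: "w \<in> pverts G" "w \<noteq> v" "w \<notin> ?X" by auto
  have "connected (with_proj G \<restriction> (pverts G - ?X))"
    using k X sub(1) by (simp add: k_connected_def)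
  then have "linked (parcs G) (pverts G - ?X) v w"
    using linked_if_connected[OF G] v w sub(2) by blast
  then show False using linked_start w(2) by (fastforce simp: nbs_def)
qed

text \<open>A maximal connected \<open>V\<close> whose complement \<open>H\<close> has a wheel makes
  \<open>H\<close> critical in the sense of \<open>wheel_critical\<close>; the resulting wheel has
  its rim branch vertices in \<open>N\<close>, so \<open>V\<close> is a second hub.\<close>

lemma contains_K5_minus_if_degree_ge_4:
  assumes G: "pair_graph G" and "connected (with_proj G)"
    and deg: "\<And>v. v \<in> pverts G \<Longrightarrow> 4 \<le> card (nbs (parcs G) (pverts G) v)"
  shows "contains_subdivision_of (complete_minus_edge 5) G"
proof -
  interpret G: pair_graph G by fact
  let ?E = "parcs G" and ?W = "pverts G"
  have E: "sym ?E" "irrefl ?E" using G.arcs_symmetric G.no_loops' by (auto simp: sym_def irrefl_def)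
  have fin: "finite ?W" by simp
  have "with_proj G \<restriction> ?W = with_proj G"
    using G.wellformed' by (auto simp: induce_subgraph_def with_proj_def)
  then have link: "linked ?E ?W v w" if "v \<in> ?W" "w \<in> ?W" for v w
    using linked_if_connected[OF G, of ?W] assms(2) that by simp
  define P where "P V \<longleftrightarrow> V \<subseteq> ?W \<and> conn ?E V \<and> wheel ?E (?W - V) UNIV" for V
  obtain r where r: "r \<in> ?W" using assms(2) by (auto simp: connected_def strongly_connected_def)
  have "nbs ?E ?W r \<noteq> {}" using deg[OF r] by auto
  then have "?W - {r} \<noteq> {}" using E(2) by (auto simp: nbs_def irrefl_def)
  moreover have "3 \<le> card (nbs ?E (?W - {r}) v)" if "v \<in> ?W" for v
    using deg[OF that] card_nbs_remove[OF fin, of ?E v r] by linarith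
  \<comment> \<open>Deleting one vertex leaves degree at least 3, so a single vertex is a first
    candidate for \<open>V\<close>.\<close>
  ultimately have "wheel ?E (?W - {r}) UNIV"
    using fin by (intro wheel_if_degree_ge_3[OF _ E, of _ r]) auto
  then have "P {r}" using r by (simp add: P_def)
  moreover have "\<forall>V. P V \<longrightarrow> card V < Suc (card ?W)"
    using fin by (auto simp: P_def less_Suc_eq_le intro: card_mono)
  ultimately obtain V where V: "P V" and max: "\<And>X. P X \<Longrightarrow> card X \<le> card V"
    using ex_has_greatest_nat[of P "{r}" card "Suc (card ?W)"] by blast
  define H where "H = ?W - V"
  define N where "N = {v \<in> H. nbs ?E V v \<noteq> {}}"
  have Vs: "V \<subseteq> ?W" "conn ?E V" and wheel: "wheel ?E H UNIV" using V by (auto simp: P_def H_def)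
  have finV: "finite V" using Vs fin by (rule_tac finite_subset)
  have "wheel ?E H N"
  proof (rule wheel_critical[OF _ E])
    show "finite H" "N \<subseteq> H" using fin by (auto simp: H_def N_def)
    show "wheel ?E H UNIV" by fact
    \<comment> \<open>Otherwise \<open>V\<close> could absorb \<open>x\<close>, against its
      maximality.\<close>
    show "\<not> wheel ?E (H - {x}) UNIV" if x: "x \<in> N" for x
    proof
      assume "wheel ?E (H - {x}) UNIV"
      moreover have "H - {x} = ?W - insert x V" by (auto simp: H_def)
      moreover obtain u where "u \<in> V" "(u, x) \<in> ?E" using x E(1) by (auto simp: N_def nbs_def dest: symD)
      then have "conn ?E (insert x V)" by (rule conn_insert[OF E(1) Vs(2)])
      ultimately have "P (insert x V)" using x Vs by (auto simp: P_def N_def H_def)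
      then show False using max[of "insert x V"] x finV by (auto simp: N_def H_def)
    qed
    show "4 \<le> card (nbs ?E H v)" if v: "v \<in> H - N" for v
    proof -
      have "nbs ?E ?W v = nbs ?E H v" using v by (auto simp: N_def H_def nbs_def)
      then show ?thesis using deg[of v] v by (simp add: H_def)
    qed
    obtain s where s: "s \<in> V" using Vs by (auto simp: conn_def)
    obtain h where h: "h \<in> H" using wheel by (auto simp: wheel_def wheel_at_def)
    \<comment> \<open>Otherwise \<open>V\<close> would be closed under adjacency and, by
      connectedness, contain \<open>h\<close>.\<close>
    show "N \<noteq> {}"
    proof
      assume "N = {}"
      then have closed: "u \<in> V" if "v \<in> V" "(v, u) \<in> ?E" "u \<in> ?W" for u v
        using that E(1) by (auto simp: N_def H_def nbs_def dest: symD)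
      have "(s, h) \<in> (Restr ?E ?W)\<^sup>*" using link[of s h] s h Vs by (auto simp: linked_def H_def)
      then have "h \<in> V" by (induction rule: rtrancl_induct) (use s closed in auto)
      then show False using h by (simp add: H_def)
    qed
  qed
  then obtain a b c A B C U where "a \<in> N" "b \<in> N" "c \<in> N" "wheel_at ?E H a b c A B C U"
    by (auto simp: wheel_def)
  then show ?thesis
    using Vs by (intro contains_K5_minus_if_wheel[OF G, of H a b c A B C U V]) (auto simp: N_def H_def)
qed

theorem theorem1:
  fixes G :: "'a pair_pre_digraph"
  assumes "pair_graph G"
    and "k_connected 4 G"
  shows "contains_subdivision_of (complete_minus_edge 5) G"
proof (rule contains_K5_minus_if_degree_ge_4[OF assms(1)])
  interpret G: pair_graph G by fact
  have "with_proj G \<restriction> pverts G = with_proj G"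
    using G.wellformed' by (auto simp: induce_subgraph_def with_proj_def)
  \<comment> \<open>Connectedness is the case of the empty separator.\<close>
  moreover have "connected (with_proj G \<restriction> (pverts G - {}))"
    using assms(2) unfolding k_connected_def by (metis card.empty empty_subsetI zero_less_numeral)
  ultimately show "connected (with_proj G)" by simp
qed (rule degree_ge_if_k_connected[OF assms])

end
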